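(* Let $n$ be a positive integer. For each involution $y \in \mathcal{I}(S_n)$ and each fixed-point-free involution $z \in \mathcal{I}(S_{2n})$, it holds that $$2^{\kappa(y)}\,\hat{\mathfrak S}_y = \Upsilon^{\mathrm{O}_n}_y \qquad\text{and}\qquad \hat{\mathfrak S}^{\mathrm{FPF}}_z = \Upsilon^{\mathrm{Sp}_{2n}}_z .$$
   Context: Let $s_i=(i,i+1)$. $\mathcal I(S_n)=\{w\in S_n: w=w^{-1}\}$ (the identity is included), and $\kappa(y)$ is the number of 2-cycles of $y\in\mathcal I(S_n)$. For an involution $y$ and an index $i$, set $y\rtimes s_i = ys_i$ if $ys_i=s_iy$ and $y\rtimes s_i=s_iys_i$ otherwise. An involution word for an involution $z$ is a sequence of positive integers $(a_1,\dots,a_k)$ of shortest possible length such that $z=(\cdots((1\rtimes s_{a_1})\rtimes s_{a_2})\rtimes\cdots)\rtimes s_{a_k}$; $\hat{\mathcal R}(z)$ is the set of these. For involutions $y,z$, $\hat{\mathcal R}(y,z)$ is the set of sequences which, when appended to involution words of $y$, produce involution words of $z$ (this does not depend on the chosen involution word of $y$). For a sequence $a=(a_1,\dots,a_k)$ of positive integers, $C(a)$ is the set of sequences of positive integers $I=(i_1\le i_2\le\dots\le i_k)$ with $i_j<i_{j+1}$ whenever $a_j<a_{j+1}$; $I\le a$ means $i_j\le a_j$ for all $j$; $x_I=x_{i_1}\cdots x_{i_k}$. The involution Schubert polynomials are $$\hat{\mathfrak S}_{y,z}=\sum_{a\in\hat{\mathcal R}(y,z)}\ \sum_{I\in C(a),\,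 I\le a}x_I,\qquad \hat{\mathfrak S}_y=\hat{\mathfrak S}_{1,y},\qquad \hat{\mathfrak S}^{\mathrm{FPF}}_z=\hat{\mathfrak S}_{v_n,z},$$ where $v_n=(1,2)(3,4)\cdots(2n-1,2n)\in S_{2n}$. The divided difference operators are $\partial_i f=(f-s_if)/(x_i-x_{i+1})$, where $s_i$ exchanges $x_i$ and $x_{i+1}$. Let $w_n=[n,n-1,\dots,1]\in S_n$. The Wyser–Yong polynomials $\Upsilon$ (which represent the cohomology classes of the $\mathrm O_n(\mathbb C)$- and $\mathrm{Sp}_{2n}(\mathbb C)$-orbit closures in the flag variety) are defined as follows: $$\Upsilon^{\mathrm O_n}_{w_n}=\prod_{1\le i\le j\le n-i}(x_i+x_j),\qquad \Upsilon^{\mathrm{Sp}_{2n}}_{w_{2n}}=\prod_{1\le i<j\le 2n-i}(x_i+x_j),$$ and for $y\in\mathcal I(S_n)$ and any $(a_1,\dots,a_k)\in\hat{\mathcal R}(y,w_n)$, $$\Upsilon^{\mathrm O_n}_y=2^{\kappa(y)-\kappa(w_n)}\,\partial_{a_1}\partial_{a_2}\cdots\partial_{a_k}\Upsilon^{\mathrm O_n}_{w_n},$$ while for fixed-point-free $z\in\mathcal I(S_{2n})$ and any $(a_1,\dots,a_k)\in\hat{\mathcal R}(z,w_{2n})$, $$\Upsilon^{\mathrm{Sp}_{2n}}_z=\partial_{a_1}\partial_{a_2}\cdots\partial_{a_k}\Upsilon^{\mathrm{Sp}_{2n}}_{w_{2n}}.$$ By a theorem of Wyser and Yong, these do not depend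 on the choice of the sequence $(a_1,\dots,a_k)$. *)

theory Defs
  imports Complex_Main "HOL-Combinatorics.Permutations" "HOL-Library.Poly_Mapping"
begin

section \<open>Involutions and involution words\<close>

text \<open>Elements of \<open>S\<^sub>n\<close> are functions on \<^typ>\<open>nat\<close> permuting \<open>{1..n}\<close> and fixing every other number,
  so that \<open>S\<^sub>n \<subseteq> S\<^sub>n\<^sub>+\<^sub>1\<close> literally.\<close>

definition simple_refl :: "nat \<Rightarrow> nat \<Rightarrow> nat" where
  "simple_refl i = transpose i (i + 1)"

definition involutions :: "nat \<Rightarrow> (nat \<Rightarrow> nat) set" where
  "involutions n = {w. w permutes {1..n} \<and> w = inv w}"

definition fpf_involutions :: "nat \<Rightarrow> (nat \<Rightarrow> nat) set" where
  "fpf_involutions n = {w \<in> involutions n. \<forall>i\<in>{1..n}. w i \<noteq> i}"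

text \<open>A 2-cycle \<open>(i, j)\<close> is counted once, as the pair with \<open>i < j\<close>.\<close>

definition num_two_cycles :: "(nat \<Rightarrow> nat) \<Rightarrow> nat" where
  "num_two_cycles y = card {(i, j). i < j \<and> y i = j \<and> y j = i}"

definition inv_act :: "(nat \<Rightarrow> nat) \<Rightarrow> nat \<Rightarrow> (nat \<Rightarrow> nat)" where
  "inv_act y i =
     (if y \<circ> simple_refl i = simple_refl i \<circ> y
      then y \<circ> simple_refl i
      else simple_refl i \<circ> y \<circ> simple_refl i)"

definition inv_words :: "(nat \<Rightarrow> nat) \<Rightarrow> nat list set" where
  "inv_words z = {a. is_arg_min length (\<lambda>b. 0 \<notin> set b \<and> z = foldl inv_act id b) a}"

definition inv_words_between :: "(nat \<Rightarrow> nat) \<Rightarrow> (nat \<Rightarrow> nat) \<Rightarrow> nat list set" where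
  "inv_words_between y z = {b. \<exists>a\<in>inv_words y. a @ b \<in> inv_words z}"

text \<open>The choice of the involution word of \<open>y\<close> is immaterial.\<close>

lemma inv_words_between_eq:
  assumes "a \<in> inv_words y"
  shows "inv_words_between y z = {b. a @ b \<in> inv_words z}"
proof -
  have "a @ b \<in> inv_words z"
    if a': "a' \<in> inv_words y" and b: "a' @ b \<in> inv_words z" for a' b
  proof -
    have "\<not> length a < length a'" "\<not> length a' < length a"
      using a' assms unfolding inv_words_def is_arg_min_def by blast+
    then have "length a = length a'"
      by simp
    with a' b assms show ?thesis
      unfolding inv_words_def is_arg_min_def by auto
  qed
  with assms show ?thesis
    unfolding inv_words_between_def by blast
qed

definition longest_perm :: "nat \<Rightarrow> nat \<Rightarrow> nat" where
  "longest_perm n i = (if i \<in> {1..n} then n + 1 - i else i)"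

definition fpf_base :: "nat \<Rightarrow> nat \<Rightarrow> nat" where
  "fpf_base n i = (if i \<in> {1..2 * n} then (if odd i then i + 1 else i - 1) else i)"


section \<open>Polynomials and divided differences\<close>

text \<open>Polynomials in \<open>x\<^sub>0, x\<^sub>1, x\<^sub>2, \<dots>\<close> as finitely supported maps from exponent vectors to
  coefficients (\<open>x\<^sub>0\<close> is never used). Coefficients are rational because the power of 2 in the
  definition of \<open>upsilon_O\<close> has a nonpositive exponent.\<close>

type_synonym mpoly = "(nat \<Rightarrow>\<^sub>0 nat) \<Rightarrow>\<^sub>0 rat"

definition Const :: "rat \<Rightarrow> mpoly" where
  "Const c = Poly_Mapping.single 0 c"

definition Var :: "nat \<Rightarrow> mpoly" where
  "Var i = Poly_Mapping.single (Poly_Mapping.single i 1) 1"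

text \<open>The coefficient of a monomial \<open>m\<close> in \<open>swap_vars i f\<close> is the coefficient in \<open>f\<close> of the
  monomial obtained from \<open>m\<close> by exchanging the exponents of \<open>x\<^sub>i\<close> and \<open>x\<^sub>i\<^sub>+\<^sub>1\<close>.\<close>

definition swap_vars :: "nat \<Rightarrow> mpoly \<Rightarrow> mpoly" where
  "swap_vars i f = Poly_Mapping.map_key (Poly_Mapping.map_key (simple_refl i)) f"

lemma inj_simple_refl: "inj (simple_refl i)"
  by (simp add: simple_refl_def)

lemma map_key_simple_refl_involutory:
  "Poly_Mapping.map_key (simple_refl i) (Poly_Mapping.map_key (simple_refl i) m) = m"
proof -
  have "simple_refl i \<circ> simple_refl i = (\<lambda>x. x)"
    by (auto simp: simple_refl_def fun_eq_iff)
  then show ?thesis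
    by (simp add: Poly_Mapping.map_key_compose inj_simple_refl Poly_Mapping.map_key_id)
qed

lemma inj_map_key_simple_refl:
  "inj (Poly_Mapping.map_key (simple_refl i) :: (nat \<Rightarrow>\<^sub>0 nat) \<Rightarrow> _)"
  by (metis injI map_key_simple_refl_involutory)

lemma lookup_swap_vars:
  "Poly_Mapping.lookup (swap_vars i f) m =
     Poly_Mapping.lookup f (Poly_Mapping.map_key (simple_refl i) m)"
  by (simp add: swap_vars_def Poly_Mapping.map_key.rep_eq inj_map_key_simple_refl)

lemma swap_vars_Var: "swap_vars i (Var j) = Var (simple_refl i j)"
proof -
  have "Poly_Mapping.single j (1::nat) =
      Poly_Mapping.map_key (simple_refl i) (Poly_Mapping.single (simple_refl i j) 1)"
    by (rule Poly_Mapping.map_key_single[OF inj_simple_refl, symmetric])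
  then show ?thesis
    unfolding swap_vars_def Var_def
    by (simp add: Poly_Mapping.map_key_single inj_map_key_simple_refl)
qed

text \<open>The quotient of \<open>f - s\<^sub>i f\<close> by \<open>x\<^sub>i - x\<^sub>i\<^sub>+\<^sub>1\<close>; it is unique because \<^typ>\<open>mpoly\<close> is an
  integral domain.\<close>

definition divdiff :: "nat \<Rightarrow> mpoly \<Rightarrow> mpoly" where
  "divdiff i f = (THE g. g * (Var i - Var (i + 1)) = f - swap_vars i f)"

text \<open>\<open>divdiff_word [a\<^sub>1, \<dots>, a\<^sub>k] f = divdiff a\<^sub>1 (\<dots> (divdiff a\<^sub>k f))\<close>\<close>

definition divdiff_word :: "nat list \<Rightarrow> mpoly \<Rightarrow> mpoly" where
  "divdiff_word a f = foldr divdiff a f"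


section \<open>Involution Schubert polynomials\<close>

definition compatible_seqs :: "nat list \<Rightarrow> nat list set" where
  "compatible_seqs a =
     {I. length I = length a \<and> 0 \<notin> set I \<and> sorted I \<and>
         (\<forall>j. Suc j < length a \<longrightarrow> a ! j < a ! Suc j \<longrightarrow> I ! j < I ! Suc j)}"

definition inv_schubert_between :: "(nat \<Rightarrow> nat) \<Rightarrow> (nat \<Rightarrow> nat) \<Rightarrow> mpoly" where
  "inv_schubert_between y z =
     (\<Sum>a\<in>inv_words_between y z.
        \<Sum>I\<in>{I \<in> compatible_seqs a. list_all2 (\<le>) I a}. prod_list (map Var I))"

definition inv_schubert :: "(nat \<Rightarrow> nat) \<Rightarrow> mpoly" where
  "inv_schubert y = inv_schubert_between id y"

definition fpf_inv_schubert :: "nat \<Rightarrow> (nat \<Rightarrow> nat) \<Rightarrow> mpoly" where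
  "fpf_inv_schubert n z = inv_schubert_between (fpf_base n) z"


section \<open>Wyser--Yong polynomials\<close>

text \<open>The definite descriptions below say that the polynomial obtained from a word
  in \<open>inv_words_between y (longest_perm n)\<close> does not depend on the word: they denote the only
  element of the set of all polynomials obtained in this way.\<close>

definition upsilon_O_longest :: "nat \<Rightarrow> mpoly" where
  "upsilon_O_longest n = (\<Prod>i = 1..n. \<Prod>j = i..n - i. Var i + Var j)"

definition upsilon_O :: "nat \<Rightarrow> (nat \<Rightarrow> nat) \<Rightarrow> mpoly" where
  "upsilon_O n y =
     (THE p. \<exists>a\<in>inv_words_between y (longest_perm n).
        p = Const (2 powi (int (num_two_cycles y) - int (num_two_cycles (longest_perm n))))
            * divdiff_word a (upsilon_O_longest n))"

text \<open>The second argument of \<open>upsilon_Sp\<close> is an involution in \<open>S\<^sub>2\<^sub>n\<close>.\<close>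

definition upsilon_Sp_longest :: "nat \<Rightarrow> mpoly" where
  "upsilon_Sp_longest n = (\<Prod>i = 1..2 * n. \<Prod>j = i + 1..2 * n - i. Var i + Var j)"

definition upsilon_Sp :: "nat \<Rightarrow> (nat \<Rightarrow> nat) \<Rightarrow> mpoly" where
  "upsilon_Sp n z =
     (THE p. \<exists>a\<in>inv_words_between z (longest_perm (2 * n)).
        p = divdiff_word a (upsilon_Sp_longest n))"

end

theory Submission
  imports Defs "HOL-Library.Sublist"
begin

text \<open>Let \<open>u\<^sub>i\<close> act on the free module over involutions by \<open>y u\<^sub>i = y \<rtimes> s\<^sub>i\<close> if this is longer than \<open>y\<close>,
  and \<open>y u\<^sub>i = 0\<close> otherwise. These operators satisfy the nilCoxeter relations, and
  \<open>\<SS>\<^sub>y\<^sub>,\<^sub>z\<close> is the coefficient of \<open>z\<close> in \<open>y A\<^sub>1(x\<^sub>1) A\<^sub>2(x\<^sub>2) \<cdots>\<close> with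
  \<open>A\<^sub>i(x) = (1 + x u\<^sub>N\<^sub>-\<^sub>1) \<cdots> (1 + x u\<^sub>i)\<close>. As in the Fomin--Stanley treatment of Schubert polynomials,
  applying \<open>\<partial>\<^sub>i\<close> to this product amounts to multiplying it by \<open>u\<^sub>i\<close> on the right, so it remains to
  compute the coefficient of the longest element. The starting points \<open>1\<close> and \<open>v\<^sub>n\<close> satisfy
  \<open>y A\<^sub>1(x) = y (1 + x u\<^sub>1) \<cdots> (1 + x u\<^sub>N\<^sub>-\<^sub>1)\<close>, and the Yang--Baxter equation then turns
  \<open>y A\<^sub>1(x\<^sub>1) A\<^sub>2(x\<^sub>2) \<cdots>\<close> into
  \<open>y A\<^sub>3(x\<^sub>2) A\<^sub>4(x\<^sub>3) \<cdots> (1 + x\<^sub>1 u\<^sub>1) (1 + (x\<^sub>1 + x\<^sub>2) u\<^sub>2) \<cdots> (1 + (x\<^sub>1 + x\<^sub>N\<^sub>-\<^sub>1) u\<^sub>N\<^sub>-\<^sub>1)\<close>.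
  Reading off the top coefficient splits off the factors \<open>x\<^sub>1 + x\<^sub>j\<close> and reduces \<open>N\<close> by 2.\<close>

section \<open>Length of involutions\<close>

text \<open>No bound n is fixed here and 0 may be moved, so \<open>inv_act z i\<close> stays in this
  class for every i; finite support is what makes the inversion counts meaningful.\<close>

definition invol :: "(nat \<Rightarrow> nat) \<Rightarrow> bool" where
  "invol z \<longleftrightarrow> (\<forall>x. z (z x) = x) \<and> finite {x. z x \<noteq> x}"

definition inversions :: "(nat \<Rightarrow> nat) \<Rightarrow> (nat \<times> nat) set" where
  "inversions z = {(a, b). a < b \<and> z b < z a}"

definition exceedances :: "(nat \<Rightarrow> nat) \<Rightarrow> nat set" where
  "exceedances z = {a. a < z a}"

text \<open>Twice the length of an involution word of \<open>z\<close>: an involution has as many exceedances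
  as 2-cycles.\<close>

definition dlen :: "(nat \<Rightarrow> nat) \<Rightarrow> nat" where
  "dlen z = card (inversions z) + card (exceedances z)"

lemma simple_refl_simps [simp]:
  "simple_refl i i = Suc i" "simple_refl i (Suc i) = i"
  "j \<noteq> i \<Longrightarrow> j \<noteq> Suc i \<Longrightarrow> simple_refl i j = j"
  "simple_refl i (simple_refl i j) = j"
  by (auto simp: simple_refl_def transpose_def)

lemma simple_refl_apply: "simple_refl i j = (if j = i then Suc i else if j = Suc i then i else j)"
  by auto

lemma simple_refl_eq_iff [simp]: "simple_refl i j = simple_refl i k \<longleftrightarrow> j = k"
  by (metis simple_refl_simps(4))

lemma simple_refl_less_iff:
  "simple_refl i p < simple_refl i q \<longleftrightarrow> p < q \<and> \<not> (p = i \<and> q = Suc i) \<or> p = Suc i \<and> q = i"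
  by (auto simp: simple_refl_apply)

lemma invol_apply: "invol z \<Longrightarrow> z (z x) = x"
  by (simp add: invol_def)

lemma invol_eq_iff: "invol z \<Longrightarrow> z x = z y \<longleftrightarrow> x = y"
  by (metis invol_apply)

lemma invol_id [simp]: "invol id"
  by (simp add: invol_def)

text \<open>Commuting with \<open>simple_refl i\<close> means preserving the pair {i, i+1}, and a
  bijection does so either pointwise or by exchanging the two.\<close>

lemma simple_refl_commute_iff:
  assumes "invol z"
  shows "z \<circ> simple_refl i = simple_refl i \<circ> z \<longleftrightarrow>
    z i = i \<and> z (Suc i) = Suc i \<or> z i = Suc i \<and> z (Suc i) = i"
    (is "?L \<longleftrightarrow> ?R")
proof
  assume ?L
  then have *: "z (simple_refl i x) = simple_refl i (z x)" for x
    by (metis comp_apply)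
  show ?R
    using *[of i] *[of "Suc i"] *[of "z i"] invol_eq_iff[OF assms] invol_apply[OF assms]
    by (metis n_not_Suc_n simple_refl_simps(1,2,3))
next
  assume R: ?R
  have "z (simple_refl i x) = simple_refl i (z x)" for x
    using R by (smt (verit) assms invol_apply simple_refl_apply)
  then show ?L
    by auto
qed

lemma inv_act_apply:
  assumes "invol z"
  shows "inv_act z i x = (if z i = i \<and> z (Suc i) = Suc i \<or> z i = Suc i \<and> z (Suc i) = i
     then z (simple_refl i x) else simple_refl i (z (simple_refl i x)))"
  using simple_refl_commute_iff[OF assms] by (auto simp: inv_act_def)

lemma invol_inv_act:
  assumes "invol z"
  shows "invol (inv_act z i)"
  unfolding invol_def
proof
  show "\<forall>x. inv_act z i (inv_act z i x) = x"
  proof (cases "z \<circ> simple_refl i = simple_refl i \<circ> z")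
    case True
    then show ?thesis
      using invol_apply[OF assms] by (auto simp: inv_act_def fun_eq_iff)
  next
    case False
    then show ?thesis
      using invol_apply[OF assms] by (simp add: inv_act_def)
  qed
  have "{x. inv_act z i x \<noteq> x} \<subseteq> {x. z x \<noteq> x} \<union> {i, Suc i}"
    by (auto simp: inv_act_def simple_refl_apply split: if_splits)
  then show "finite {x. inv_act z i x \<noteq> x}"
    using assms by (auto simp: invol_def intro: finite_subset)
qed

lemma inv_act_inv_act:
  assumes "invol z"
  shows "inv_act (inv_act z i) i = z"
  using inv_act_apply[OF invol_inv_act[OF assms]] inv_act_apply[OF assms] invol_apply[OF assms]
  by (auto simp: fun_eq_iff simple_refl_apply invol_eq_iff[OF assms])

text \<open>\<open>simple_refl i\<close> reverses the order of no pair of values except {i, i+1}.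
  Outside the commuting case z does not map {i, i+1} to itself, so only the exchange of positions
  matters.\<close>

lemma inv_act_less:
  assumes "invol z"
  shows "inv_act z i i < inv_act z i (Suc i) \<longleftrightarrow> z (Suc i) < z i"
proof (cases "z i = i \<and> z (Suc i) = Suc i \<or> z i = Suc i \<and> z (Suc i) = i")
  case True
  then show ?thesis by (simp add: inv_act_apply assms)
next
  case False
  then have "\<not> (z i = i \<and> z (Suc i) = Suc i)" "\<not> (z i = Suc i \<and> z (Suc i) = i)"
    by blast+
  with False show ?thesis 
    by (auto simp: inv_act_apply assms simple_refl_less_iff)
qed

lemma inv_act_greater:
  assumes "invol z"
  shows "inv_act z i (Suc i) < inv_act z i i \<longleftrightarrow> z i < z (Suc i)"
  using inv_act_less[OF assms, of i] invol_eq_iff[OF assms] invol_eq_iff[OF invol_inv_act[OF assms]]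
  by (metis linorder_neqE_nat n_not_Suc_n order_less_asym)

lemma finite_exceedances:
  assumes "invol z"
  shows "finite (exceedances z)"
  using assms by (auto simp: invol_def exceedances_def intro: finite_subset[rotated])

lemma finite_inversions:
  assumes "invol z"
  shows "finite (inversions z)"
proof -
  obtain M where M: "\<And>x. z x \<noteq> x \<Longrightarrow> x \<le> M"
    using assms unfolding invol_def finite_nat_set_iff_bounded_le by auto
  have "b \<le> M" if "a < b" "z b < z a" for a b
    using that M[of b] M[of "z a"] M[of a] invol_apply[OF assms, of a] by (metis linorder_not_le nle_le order_less_trans)
  then have "inversions z \<subseteq> {..M} \<times> {..M}"
    by (force simp: inversions_def)
  then show ?thesis
    using finite_subset by blast
qed

text \<open>If z exchanges i and i+1, one inversion and one exceedance disappear. Otherwise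
  conjugation removes two inversions and merely permutes the exceedances. Either way the loss is 2,
  which is why \<open>dlen\<close> adds the two counts.\<close>

lemma dlen_inv_act:
  assumes z: "invol z" and d: "z (Suc i) < z i"
  shows "dlen z = dlen (inv_act z i) + 2"
proof (cases "z i = Suc i \<and> z (Suc i) = i")
  case True
  let ?f = "\<lambda>(p, q). (simple_refl i p, simple_refl i q)"
  have "inversions (inv_act z i) = ?f ` (inversions z - {(i, Suc i)})"
  proof -
    have "(a, b) \<in> inversions (inv_act z i) \<longleftrightarrow> ?f (a, b) \<in> inversions z - {(i, Suc i)}" for a b
      using True by (auto simp: inversions_def inv_act_apply[OF z] simple_refl_less_iff)
        (auto simp: simple_refl_apply split: if_splits)
    then show ?thesis
      by (force simp: image_iff)
  qed
  moreover have "inj_on ?f S" for S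
    by (auto simp: inj_on_def)
  moreover have "(i, Suc i) \<in> inversions z"
    using True by (auto simp: inversions_def)
  ultimately have 1: "card (inversions z) = Suc (card (inversions (inv_act z i)))"
    using finite_inversions[OF z] by (simp add: card_image card_Suc_Diff1 del: card_Diff_insert)
  have "exceedances (inv_act z i) = exceedances z - {i}"
    using True by (auto simp: exceedances_def inv_act_apply[OF z] simple_refl_apply split: if_splits)
  moreover have "i \<in> exceedances z"
    using True by (auto simp: exceedances_def)
  ultimately have 2: "card (exceedances z) = Suc (card (exceedances (inv_act z i)))"
    using finite_exceedances[OF z] by (metis card_Suc_Diff1)
  show ?thesis
    using 1 2 by (simp add: dlen_def)
next
  case False
  let ?f = "\<lambda>(p, q). (simple_refl i p, simple_refl i q)"
  \<comment> \<open>An involution has its inversions in mirror pairs \<open>(a, b)\<close> and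
    \<open>(z b, z a)\<close>. The mirror of \<open>(i, Suc i)\<close> differs from it precisely
    because z does not exchange i and i+1.\<close>
  let ?D = "{(i, Suc i), (z (Suc i), z i)}"
  have nc: "\<not> (z i = i \<and> z (Suc i) = Suc i \<or> z i = Suc i \<and> z (Suc i) = i)"
    using False d by auto
  have "inversions (inv_act z i) = ?f ` (inversions z - ?D)"
  proof -
    have "(a, b) \<in> inversions (inv_act z i) \<longleftrightarrow> ?f (a, b) \<in> inversions z - ?D" for a b
    proof -
      define p q where pq: "p = simple_refl i a" "q = simple_refl i b"
      have ab: "a = simple_refl i p" "b = simple_refl i q"
        by (simp_all add: pq)
      have "(a, b) \<in> inversions (inv_act z i) \<longleftrightarrow>
          simple_refl i p < simple_refl i q \<and> simple_refl i (z q) < simple_refl i (z p)"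
        using nc by (auto simp: inversions_def inv_act_apply[OF z] pq)
      also have "\<dots> \<longleftrightarrow> (p, q) \<in> inversions z - ?D"
        using nc d invol_apply[OF z]
        unfolding simple_refl_less_iff inversions_def by (smt (verit) DiffE DiffI case_prodD case_prodI empty_iff insert_iff mem_Collect_eq old.prod.inject order_less_asym prod.inject lessI)
      finally show ?thesis
        by (simp add: pq)
    qed
    then show ?thesis
      by (force simp: image_iff)
  qed
  moreover have "inj_on ?f S" for S
    by (auto simp: inj_on_def)
  moreover have "?D \<subseteq> inversions z"
    using d by (auto simp: inversions_def invol_apply[OF z])
  moreover have "card ?D = 2"
    using nc by auto
  ultimately have 1: "card (inversions z) = card (inversions (inv_act z i)) + 2"
    using finite_inversions[OF z] card_mono[of "inversions z" ?D]
    by (simp add: card_image card_Diff_subset del: card_Diff_insert)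
  have "exceedances (inv_act z i) = simple_refl i ` exceedances z"
  proof -
    have "a \<in> exceedances (inv_act z i) \<longleftrightarrow> simple_refl i a \<in> exceedances z" for a
    proof -
      define p where "p = simple_refl i a"
      have a: "a = simple_refl i p"
        by (simp add: p_def)
      have "a \<in> exceedances (inv_act z i) \<longleftrightarrow> simple_refl i p < simple_refl i (z p)"
        using nc by (auto simp: exceedances_def inv_act_apply[OF z] a)
      also have "\<dots> \<longleftrightarrow> p \<in> exceedances z"
        using nc invol_apply[OF z] by (auto simp: exceedances_def simple_refl_less_iff) metis+
      finally show ?thesis
        by (simp add: p_def)
    qed
    then show ?thesis
      by (metis (no_types, lifting) image_iff set_eqI simple_refl_simps(4))
  qed
  then have 2: "card (exceedances z) = card (exceedances (inv_act z i))"
    by (simp add: card_image inj_on_def)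
  show ?thesis
    using 1 2 by (simp add: dlen_def)
qed

lemma dlen_inv_act_ascent:
  assumes z: "invol z" and d: "z i < z (Suc i)"
  shows "dlen (inv_act z i) = dlen z + 2"
  using dlen_inv_act[OF invol_inv_act[OF z], of i i] inv_act_greater[OF z, of i] d inv_act_inv_act[OF z]
  by simp

lemma invol_ascent_or_descent:
  assumes "invol z"
  shows "z i < z (Suc i) \<or> z (Suc i) < z i"
  using invol_eq_iff[OF assms, of i "Suc i"] by auto

section \<open>Involution words as ascending paths\<close>

text \<open>Every letter must lengthen the involution reached so far. Positivity of the letters is
  imposed separately.\<close>

fun asc_path :: "(nat \<Rightarrow> nat) \<Rightarrow> nat list \<Rightarrow> bool" where
  "asc_path y [] = True"
| "asc_path y (i # b) = (y i < y (Suc i) \<and> asc_path (inv_act y i) b)"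

lemma asc_path_append: "asc_path y (a @ b) \<longleftrightarrow> asc_path y a \<and> asc_path (foldl inv_act y a) b"
  by (induction a arbitrary: y) auto

lemma invol_foldl: "invol y \<Longrightarrow> invol (foldl inv_act y b)"
  by (induction b arbitrary: y) (auto simp: invol_inv_act)

text \<open>A letter changes \<open>dlen\<close> by +2 or -2, so the largest possible gain is
  reached exactly when no letter goes down.\<close>

lemma dlen_foldl:
  assumes "invol y"
  shows "dlen (foldl inv_act y b) \<le> dlen y + 2 * length b"
    and "dlen (foldl inv_act y b) = dlen y + 2 * length b \<longleftrightarrow> asc_path y b"
  using assms
proof (induction b arbitrary: y)
  case (Cons i b)
  have IH: "dlen (foldl inv_act (inv_act y i) b) \<le> dlen (inv_act y i) + 2 * length b"
    "dlen (foldl inv_act (inv_act y i) b) = dlen (inv_act y i) + 2 * length b \<longleftrightarrow> asc_path (inv_act y i) b"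
    if "invol y" for y
    using Cons.IH invol_inv_act[OF that] by blast+
  {
    case 1
    show ?case
    proof (cases "y i < y (Suc i)")
      case True
      then show ?thesis
        using IH(1)[OF 1] dlen_inv_act_ascent[OF 1 True] by simp
    next
      case False
      then have "y (Suc i) < y i"
        using invol_ascent_or_descent[OF 1, of i] by simp
      then show ?thesis
        using IH(1)[OF 1] dlen_inv_act[OF 1, of i] by simp
    qed
  next
    case 2
    show ?case
    proof (cases "y i < y (Suc i)")
      case True
      then show ?thesis
        using IH(2)[OF 2] dlen_inv_act_ascent[OF 2 True] by simp
    next
      case False
      then have "y (Suc i) < y i"
        using invol_ascent_or_descent[OF 2, of i] by simp
      then show ?thesis
        using IH(1)[OF 2] dlen_inv_act[OF 2, of i] False by simp
    qed
  }
qed auto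

section \<open>Involutions of {1..n}: descents, ascents and extreme elements\<close>

lemma in_involutions_iff:
  "y \<in> involutions n \<longleftrightarrow> (\<forall>x. y (y x) = x) \<and> (\<forall>x. x \<notin> {1..n} \<longrightarrow> y x = x)"
proof
  assume "y \<in> involutions n"
  then show "(\<forall>x. y (y x) = x) \<and> (\<forall>x. x \<notin> {1..n} \<longrightarrow> y x = x)"
    unfolding involutions_def by (metis (mono_tags, lifting) mem_Collect_eq permutes_inverses(2) permutes_not_in)
next
  assume *: "(\<forall>x. y (y x) = x) \<and> (\<forall>x. x \<notin> {1..n} \<longrightarrow> y x = x)"
  then have "inv y = y"
    by (intro inv_unique_comp) auto
  moreover have "y permutes {1..n}"
    unfolding permutes_def
  proof (intro conjI allI)
    show "\<exists>!x. y x = b" for b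
      using * by (intro ex1I[of _ "y b"]) auto
  qed (use * in blast)
  ultimately show "y \<in> involutions n"
    by (simp add: involutions_def)
qed

lemma invol_involutions: "y \<in> involutions n \<Longrightarrow> invol y"
  unfolding in_involutions_iff invol_def by (metis (mono_tags, lifting) finite_atLeastAtMost finite_subset mem_Collect_eq subsetI)

lemma involutions_fixed: "y \<in> involutions n \<Longrightarrow> x \<notin> {1..n} \<Longrightarrow> y x = x"
  unfolding in_involutions_iff by blast

lemma id_in_involutions [simp]: "id \<in> involutions n"
  by (simp add: in_involutions_iff)

lemma inv_act_in_involutions:
  assumes y: "y \<in> involutions n" and "0 < i" "i < n"
  shows "inv_act y i \<in> involutions n"
proof -
  have "inv_act y i x = x" if "x \<notin> {1..n}" for x
  proof -
    have "y x = x" "x \<noteq> i" "x \<noteq> Suc i"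
      using assms(2,3) that involutions_fixed[OF y that] by auto
    then show ?thesis
      by (simp add: inv_act_apply[OF invol_involutions[OF y]])
  qed
  then show ?thesis
    using invol_inv_act[OF invol_involutions[OF y]] unfolding in_involutions_iff invol_def by blast
qed

lemma involutions_le:
  assumes "y \<in> involutions n" "i \<le> n"
  shows "y i \<le> n"
  using assms unfolding in_involutions_iff by (metis atLeastAtMost_iff linorder_not_le order_less_le_trans order.asym)

lemma descent_less:
  assumes y: "y \<in> involutions n" and d: "y (Suc i) < y i"
  shows "i < n"
proof (rule ccontr)
  assume "\<not> i < n"
  then have "y i \<le> i" "y (Suc i) = Suc i"
    using involutions_le[OF y, of i] involutions_fixed[OF y, of i] involutions_fixed[OF y, of "Suc i"] by (cases "i = n"; auto)+
  with d show False
    by simp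
qed

lemma descent_pos:
  assumes y: "y \<in> involutions n" and d: "y (Suc i) < y i"
  shows "0 < i"
  using d involutions_fixed[OF y, of 0] by (cases i) auto

text \<open>Without descents an involution is strictly increasing, and a strictly increasing
  involution is the identity.\<close>

lemma exists_descent:
  assumes y: "y \<in> involutions n" and "y \<noteq> id"
  obtains i where "y (Suc i) < y i"
proof -
  have "y = id" if "\<And>i. \<not> y (Suc i) < y i"
  proof -
    have "strict_mono y"
      using that invol_ascent_or_descent[OF invol_involutions[OF y]] by (auto simp: strict_mono_Suc_iff)
    then have "y i = i" for i
      using y unfolding in_involutions_iff by (metis linorder_neqE_nat order_less_asym strict_mono_less)
    then show ?thesis
      by auto
  qed
  with assms that show ?thesis
    by blast
qed

lemma exists_ascent:
  assumes y: "y \<in> involutions n" and "y \<noteq> longest_perm n"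
  obtains i where "0 < i" "i < n" "y i < y (Suc i)"
proof -
  have "y = longest_perm n" if *: "\<And>i. 0 < i \<Longrightarrow> i < n \<Longrightarrow> y (Suc i) < y i"
  proof -
    \<comment> \<open>On {1..n} this is y followed by the reversal. If y descends at every interior
      position, g is strictly increasing on all naturals, and the aim is to show that g is the
      identity.\<close>
    define g where "g i = (if i \<in> {1..n} then n + 1 - y i else i)" for i
    have le: "y i \<le> n" if "i \<le> n" for i
      using involutions_le[OF y that] .
    have pos: "0 < y i" if "0 < i" for i
      using y that unfolding in_involutions_iff by (metis atLeastAtMost_iff gr0I not_one_le_zero)
    have "g i < g (Suc i)" for i
      using *[of i] le[of i] le[of "Suc i"] pos[of "Suc i"] pos[of i] by (auto simp: g_def)
    then have mono: "strict_mono g"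
      by (simp add: strict_mono_Suc_iff)
    have ge: "i \<le> g i" for i
      using mono by (rule strict_mono_imp_increasing)
    \<comment> \<open>Growth by at least 1 per step, combined with \<open>g (n + 1) = n + 1\<close>,
      yields the upper bound \<open>g i \<le> i\<close>.\<close>
    have "g i + k \<le> g (i + k)" for i k
    proof (induction k)
      case (Suc k)
      then show ?case
        using strict_monoD[OF mono, of "i + k" "Suc (i + k)"] by simp
    qed simp
    note shift = this
    have "g i \<le> i" for i
    proof (cases "i \<le> n")
      case True
      have "g (n + 1) = n + 1"
        by (simp add: g_def)
      with shift[of i "n + 1 - i"] True show ?thesis
        by simp
    qed (simp add: g_def)
    with ge have "g i = i" for i
      by (simp add: le_antisym)
    then have "y i = longest_perm n i" for i
    proof (cases "i \<in> {1..n}")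
      case True
      then have "n + 1 - y i = i"
        using \<open>\<And>i. g i = i\<close>[of i] by (simp add: g_def)
      then show ?thesis
        using True by (auto simp: longest_perm_def)
    next
      case False
      then show ?thesis
        using False by (simp add: longest_perm_def involutions_fixed[OF y False] del: atLeastAtMost_iff)
    qed
    then show ?thesis
      by auto
  qed
  with assms that show ?thesis
    using invol_ascent_or_descent[OF invol_involutions[OF y]] by blast
qed

lemma exists_word_from_id:
  assumes "y \<in> involutions n"
  shows "\<exists>a. 0 \<notin> set a \<and> asc_path id a \<and> foldl inv_act id a = y"
  using assms
proof (induction "dlen y" arbitrary: y rule: less_induct)
  case less
  note invol = invol_involutions[OF less.prems]
  show ?case
  proof (cases "y = id")
    case True
    then show ?thesis
      by (intro exI[of _ "[]"]) auto
  next
    case False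
    then obtain i where i: "y (Suc i) < y i"
      using exists_descent less.prems by blast
    have "inv_act y i \<in> involutions n"
      using i less.prems descent_less descent_pos inv_act_in_involutions by blast
    then obtain a where a: "0 \<notin> set a" "asc_path id a" "foldl inv_act id a = inv_act y i"
      using less.hyps[of "inv_act y i"] dlen_inv_act[OF invol i] by auto
    with i show ?thesis
      using descent_pos[OF less.prems i]
      by (intro exI[of _ "a @ [i]"]) (simp add: asc_path_append inv_act_less[OF invol] inv_act_inv_act[OF invol])
  qed
qed

text \<open>A crude bound suffices: it only makes climbing towards \<open>longest_perm n\<close>
  terminate.\<close>

lemma dlen_le:
  assumes "y \<in> involutions n"
  shows "dlen y \<le> (n + 1) * (n + 1) + (n + 1)"
proof -
  have *: "x \<le> n" if "y x \<noteq> x" for x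
    using assms that unfolding in_involutions_iff by (meson atLeastAtMost_iff)
  have "inversions y \<subseteq> {..n} \<times> {..n}"
  proof (rule subrelI)
    fix a b assume "(a, b) \<in> inversions y"
    then have ab: "a < b" "y b < y a"
      by (auto simp: inversions_def)
    have "b \<le> n"
    proof (rule ccontr)
      assume "\<not> b \<le> n"
      then have "y b = b"
        using * by blast
      then show False
        using ab involutions_le[OF assms, of a] *[of a] \<open>\<not> b \<le> n\<close> by fastforce
    qed
    then show "(a, b) \<in> {..n} \<times> {..n}"
      using ab by auto
  qed
  then have "card (inversions y) \<le> (n + 1) * (n + 1)"
    using card_mono[of "{..n} \<times> {..n}"] by auto
  moreover have "exceedances y \<subseteq> {..n}"
    using * by (force simp: exceedances_def)
  then have "card (exceedances y) \<le> n + 1"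
    using card_mono[of "{..n}"] by auto
  ultimately show ?thesis
    by (simp add: dlen_def)
qed

lemma exists_word_to_longest:
  assumes "y \<in> involutions n"
  shows "\<exists>b. 0 \<notin> set b \<and> asc_path y b \<and> foldl inv_act y b = longest_perm n"
  using assms
proof (induction "(n + 1) * (n + 1) + (n + 1) - dlen y" arbitrary: y rule: less_induct)
  case less
  note invol = invol_involutions[OF less.prems]
  show ?case
  proof (cases "y = longest_perm n")
    case True
    then show ?thesis
      by (intro exI[of _ "[]"]) auto
  next
    case False
    then obtain i where i: "0 < i" "i < n" "y i < y (Suc i)"
      using exists_ascent less.prems by blast
    then have mem: "inv_act y i \<in> involutions n"
      using inv_act_in_involutions less.prems by blast
    have "(n + 1) * (n + 1) + (n + 1) - dlen (inv_act y i) < (n + 1) * (n + 1) + (n + 1) - dlen y"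
      using dlen_inv_act_ascent[OF invol i(3)] dlen_le[OF mem] by linarith
    then obtain b where "0 \<notin> set b" "asc_path (inv_act y i) b" "foldl inv_act (inv_act y i) b = longest_perm n"
      using less.hyps mem by blast
    with i show ?thesis
      by (intro exI[of _ "i # b"]) auto
  qed
qed

lemma longest_perm_in_involutions: "longest_perm n \<in> involutions n"
  by (auto simp: in_involutions_iff longest_perm_def)

lemma fpf_base_in_involutions: "fpf_base n \<in> involutions (2 * n)"
  unfolding in_involutions_iff
proof (intro conjI allI impI)
  show "fpf_base n (fpf_base n x) = x" for x
  proof (cases "x \<in> {1..2 * n}")
    case True
    then show ?thesis
      by (cases "even x") (auto simp: fpf_base_def elim!: evenE oddE, presburger)
  qed (simp add: fpf_base_def del: atLeastAtMost_iff)
qed (simp add: fpf_base_def del: atLeastAtMost_iff)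

text \<open>\<open>dlen\<close> bounds the length of every word for z from below, with equality for
  ascending words only; since an ascending word exists, the shortest words are the ascending
  ones.\<close>

lemma inv_words_iff:
  assumes z: "z \<in> involutions n"
  shows "a \<in> inv_words z \<longleftrightarrow> 0 \<notin> set a \<and> asc_path id a \<and> foldl inv_act id a = z"
proof -
  have len: "dlen z \<le> dlen id + 2 * length b \<and> (dlen z = dlen id + 2 * length b \<longleftrightarrow> asc_path id b)"
    if "z = foldl inv_act id b" for b
    using dlen_foldl[OF invol_id, of b] that by simp
  obtain c where c: "0 \<notin> set c" "asc_path id c" "foldl inv_act id c = z"
    using exists_word_from_id[OF z] by blast
  show ?thesis
  proof
    assume a: "a \<in> inv_words z"
    then have a': "(0 \<notin> set a \<and> z = foldl inv_act id a) \<and>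
        \<not> (\<exists>b. (0 \<notin> set b \<and> z = foldl inv_act id b) \<and> length b < length a)"
      unfolding inv_words_def is_arg_min_def mem_Collect_eq .
    have *: "0 \<notin> set a" "z = foldl inv_act id a" "\<not> length c < length a"
      using conjunct1[OF a'] conjunct2[OF a', unfolded not_ex, rule_format, of c] c(1) c(3)[symmetric]
      by simp_all
    have "asc_path id a"
      using len[OF *(2)] len[OF c(3)[symmetric]] c(2) *(3) by linarith
    with * show "0 \<notin> set a \<and> asc_path id a \<and> foldl inv_act id a = z"
      by blast
  next
    assume a: "0 \<notin> set a \<and> asc_path id a \<and> foldl inv_act id a = z"
    then have za: "z = foldl inv_act id a"
      by blast
    have "\<not> length b < length a" if "z = foldl inv_act id b" for b
      using len[OF za] len[OF that] a by linarith
    then show "a \<in> inv_words z"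
      using a za unfolding inv_words_def is_arg_min_def by blast
  qed
qed

lemma inv_words_between_iff:
  assumes y: "y \<in> involutions n" and z: "z \<in> involutions n"
  shows "b \<in> inv_words_between y z \<longleftrightarrow> 0 \<notin> set b \<and> asc_path y b \<and> foldl inv_act y b = z"
proof -
  obtain a where a: "0 \<notin> set a" "asc_path id a" "foldl inv_act id a = y"
    using exists_word_from_id[OF y] by blast
  then have "a \<in> inv_words y"
    using inv_words_iff[OF y] by blast
  from inv_words_between_eq[OF this, of z] a show ?thesis
    by (auto simp: inv_words_iff[OF z] asc_path_append)
qed

text \<open>Read the word from its end: the last letter is a descent of an element of S_n, hence
  lies strictly between 0 and n, and undoing it stays inside S_n.\<close>

lemma asc_path_letters:
  assumes "invol y" "0 \<notin> set b" "asc_path y b" "foldl inv_act y b \<in> involutions n"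
  shows "set b \<subseteq> {1..<n} \<and> y \<in> involutions n"
  using assms
proof (induction b rule: rev_induct)
  case (snoc i b)
  let ?q = "foldl inv_act y b"
  have q: "invol ?q" "asc_path y b" "?q i < ?q (Suc i)" "inv_act ?q i \<in> involutions n"
    using snoc.prems by (auto simp: asc_path_append invol_foldl)
  then have "inv_act ?q i (Suc i) < inv_act ?q i i"
    by (simp add: inv_act_greater)
  with q(4) have i: "0 < i" "i < n"
    using descent_pos descent_less by blast+
  then have "?q \<in> involutions n"
    using inv_act_in_involutions[OF q(4), of i] inv_act_inv_act[OF q(1)] by simp
  with snoc q i show ?case
    by auto
qed auto

section \<open>The nilCoxeter action on involutions\<close>

text \<open>One step of bubble sort on positions: the right action of the 0-Hecke monoid.
  \<open>sort_left\<close> is the same step on values, obtained by passing to inverses.\<close>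

definition sort_right :: "(nat \<Rightarrow> nat) \<Rightarrow> nat \<Rightarrow> nat \<Rightarrow> nat" where
  "sort_right f i x = (if x = i then min (f i) (f (Suc i))
     else if x = Suc i then max (f i) (f (Suc i)) else f x)"

definition sort_left :: "nat \<Rightarrow> (nat \<Rightarrow> nat) \<Rightarrow> nat \<Rightarrow> nat" where
  "sort_left i f = (if inv f (Suc i) < inv f i then simple_refl i \<circ> f else f)"

text \<open>The idempotent counterpart of removing a descent: when there is none it rests instead of
  giving zero.\<close>

definition descend :: "(nat \<Rightarrow> nat) \<Rightarrow> nat \<Rightarrow> nat \<Rightarrow> nat" where
  "descend z i = (if z (Suc i) < z i then inv_act z i else z)"

lemma sort_right_eq: "sort_right f i = (if f (Suc i) < f i then f \<circ> simple_refl i else f)"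
  by (auto simp: sort_right_def fun_eq_iff simple_refl_apply)

text \<open>Both sides sort the three entries at i, i+1, i+2.\<close>

lemma sort_right_braid:
  "sort_right (sort_right (sort_right f i) (Suc i)) i = sort_right (sort_right (sort_right f (Suc i)) i) (Suc i)"
  by (rule ext) (auto simp: sort_right_def min_def max_def)

lemma sort_right_commute:
  "Suc i < j \<Longrightarrow> sort_right (sort_right f i) j = sort_right (sort_right f j) i"
  by (rule ext) (auto simp: sort_right_def)

lemma bij_simple_refl [simp]: "bij (simple_refl i)"
  by (simp add: simple_refl_def)

lemma inv_simple_refl [simp]: "inv (simple_refl i) = simple_refl i"
  by (rule inv_equality) auto

lemma bij_sort_right: "bij f \<Longrightarrow> bij (sort_right f i)"
  by (simp add: sort_right_eq bij_comp)

lemma bij_sort_left: "bij f \<Longrightarrow> bij (sort_left i f)"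
  by (simp add: sort_left_def bij_comp)

lemma inv_sort_left: "bij f \<Longrightarrow> inv (sort_left i f) = sort_right (inv f) i"
  by (simp add: sort_left_def sort_right_eq o_inv_distrib)

lemma bij_eq_if_inv_eq:
  assumes "bij f" "bij g" "inv f = inv g"
  shows "f = g"
  using assms by (metis inv_inv_eq)

lemma sort_left_braid:
  assumes "bij f"
  shows "sort_left i (sort_left (Suc i) (sort_left i f)) = sort_left (Suc i) (sort_left i (sort_left (Suc i) f))"
  by (rule bij_eq_if_inv_eq) (simp_all add: assms bij_sort_left inv_sort_left sort_right_braid)

lemma sort_left_commute:
  assumes "bij f" "Suc i < j"
  shows "sort_left i (sort_left j f) = sort_left j (sort_left i f)"
proof (rule bij_eq_if_inv_eq)
  show "inv (sort_left i (sort_left j f)) = inv (sort_left j (sort_left i f))"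
    using sort_right_commute[OF assms(2), of "inv f"] by (simp add: assms(1) bij_sort_left inv_sort_left)
qed (simp_all add: assms bij_sort_left)

text \<open>Unless f maps {j, j+1} onto {i, i+1}, neither step affects the test made by the other.
  In the exceptional case exchanging positions and exchanging values are the same operation.\<close>

lemma sort_left_right:
  assumes "bij f"
  shows "sort_left i (sort_right f j) = sort_right (sort_left i f) j"
proof -
  define p q where "p = inv f i" and "q = inv f (Suc i)"
  have f: "f p = i" "f q = Suc i"
    using assms by (simp_all add: p_def q_def bij_is_surj surj_f_inv_f)
  have inj: "f x = f y \<longleftrightarrow> x = y" for x y
    using assms by (meson bij_is_inj inj_eq)
  have inv: "inv (f \<circ> simple_refl j) = simple_refl j \<circ> inv f"
    using assms by (simp add: o_inv_distrib)
  show ?thesis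
  proof (cases "p = j \<and> q = Suc j \<or> p = Suc j \<and> q = j")
    case True
    then have *: "simple_refl i \<circ> f = f \<circ> simple_refl j"
    proof (elim disjE)
      assume "p = j \<and> q = Suc j"
      then have fj: "f j = i" "f (Suc j) = Suc i" using f by auto
      show ?thesis
        using inj[of _ j] inj[of _ "Suc j"] by (auto simp: fun_eq_iff simple_refl_apply fj)
    next
      assume "p = Suc j \<and> q = j"
      then have fj: "f (Suc j) = i" "f j = Suc i" using f by auto
      show ?thesis
        using inj[of _ j] inj[of _ "Suc j"] by (auto simp: fun_eq_iff simple_refl_apply fj)
    qed
    show ?thesis
      using True f
      by (auto simp: sort_left_def sort_right_eq inv p_def[symmetric] q_def[symmetric] * )
  next
    case False
    have "simple_refl j q < simple_refl j p \<longleftrightarrow> q < p"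
      using False by (auto simp: simple_refl_less_iff)
    moreover have "simple_refl i (f (Suc j)) < simple_refl i (f j) \<longleftrightarrow> f (Suc j) < f j"
      using False inj f by (auto simp: simple_refl_less_iff) (metis inj)+
    ultimately show ?thesis
      by (auto simp: sort_left_def sort_right_eq inv p_def[symmetric] q_def[symmetric] comp_assoc)
  qed
qed

lemma inv_invol: "invol z \<Longrightarrow> inv z = z"
  by (rule inv_equality) (simp_all add: invol_def)

lemma bij_invol: "invol z \<Longrightarrow> bij z"
  by (rule o_bij[of z]) (auto simp: invol_def)

text \<open>Twisted conjugation is sorting on both sides. If z exchanges i and i+1, the right step
  already produces two fixed points and the left step rests.\<close>

lemma descend_eq:
  assumes "invol z"
  shows "descend z i = sort_left i (sort_right z i)"
proof (cases "z (Suc i) < z i")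
  case True
  have "inv (z \<circ> simple_refl i) = simple_refl i \<circ> z"
    by (simp add: o_inv_distrib bij_invol inv_invol assms)
  then have "sort_left i (sort_right z i) =
      (if simple_refl i (z (Suc i)) < simple_refl i (z i) then simple_refl i \<circ> (z \<circ> simple_refl i) else z \<circ> simple_refl i)"
    using True by (simp add: sort_left_def sort_right_eq)
  also have "\<dots> = inv_act z i"
    using True by (auto simp: inv_act_def simple_refl_commute_iff[OF assms] simple_refl_less_iff comp_assoc)
  finally show ?thesis
    using True by (simp add: descend_def)
next
  case False
  then show ?thesis
    by (simp add: descend_def sort_left_def sort_right_eq inv_invol assms)
qed

lemma invol_descend: "invol z \<Longrightarrow> invol (descend z i)"
  by (simp add: descend_def invol_inv_act)

text \<open>Left and right steps commute, so all left steps can be gathered outside the right ones.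
  The relations for \<open>descend\<close> thus reduce to the one-sided relations.\<close>

lemma descend_descend:
  assumes "invol z"
  shows "descend (descend z i) j = sort_left j (sort_left i (sort_right (sort_right z i) j))"
proof -
  have "descend (descend z i) j = sort_left j (sort_right (descend z i) j)"
    by (rule descend_eq[OF invol_descend[OF assms]])
  then show ?thesis
    by (simp add: descend_eq[OF assms] sort_left_right[symmetric] bij_sort_right bij_invol assms)
qed

lemma descend_descend_descend:
  assumes "invol z"
  shows "descend (descend (descend z i) j) k =
    sort_left k (sort_left j (sort_left i (sort_right (sort_right (sort_right z i) j) k)))"
proof -
  have "descend (descend (descend z i) j) k = sort_left k (sort_right (descend (descend z i) j) k)"
    by (rule descend_eq[OF invol_descend[OF invol_descend[OF assms]]])
  then show ?thesis
    by (simp add: descend_descend[OF assms] sort_left_right[symmetric] bij_sort_left bij_sort_right bij_invol assms)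
qed

lemma descend_braid:
  assumes "invol z"
  shows "descend (descend (descend z i) (Suc i)) i = descend (descend (descend z (Suc i)) i) (Suc i)"
  unfolding descend_descend_descend[OF assms] sort_right_braid
  by (intro sort_left_braid bij_sort_right bij_invol assms)

lemma descend_commute:
  assumes "invol z" "Suc i < j"
  shows "descend (descend z i) j = descend (descend z j) i"
  unfolding descend_descend[OF assms(1)] sort_right_commute[OF assms(2)]
  by (intro sort_left_commute[symmetric] bij_sort_right bij_invol assms)

section \<open>NilCoxeter operators on coefficient functions\<close>

type_synonym 'r vec = "(nat \<Rightarrow> nat) \<Rightarrow> 'r"

text \<open>Vectors are given by their coefficients, so the coefficient at z is pulled back from the
  element below z. Hence \<open>U j (U i v)\<close> is v multiplied on the right by u_i and then by
  u_j.\<close>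

definition U :: "nat \<Rightarrow> 'r vec \<Rightarrow> ('r::comm_ring_1) vec" where
  "U i v z = (if invol z \<and> z (Suc i) < z i then v (inv_act z i) else 0)"

lemma dlen_foldl_descend:
  assumes "invol z"
  shows "dlen z \<le> dlen (foldl descend z is) + 2 * length is"
  using assms
proof (induction "is" arbitrary: z)
  case (Cons i "is")
  show ?case
    using Cons.IH[OF invol_descend[OF Cons.prems, of i]] dlen_inv_act[OF Cons.prems, of i]
    by (auto simp: descend_def split: if_splits)
qed auto

text \<open>Detects idle steps of \<open>descend\<close> by length: a product of the
  \<open>U\<close> is nonzero at z only if every letter really lowers \<open>dlen\<close> by 2.
  Relations for \<open>descend\<close> between words of equal length therefore carry over to
  \<open>U\<close>.\<close>

lemma foldr_U:
  "foldr U is v z = (if invol z \<and> dlen z = dlen (foldl descend z is) + 2 * length is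
     then v (foldl descend z is) else 0)" if "invol z"
  using that
proof (induction "is" arbitrary: z)
  case (Cons i "is")
  show ?case
  proof (cases "z (Suc i) < z i")
    case True
    then have "descend z i = inv_act z i"
      by (simp add: descend_def)
    then show ?thesis
      using True Cons.IH[OF invol_inv_act[OF Cons.prems, of i]] dlen_inv_act[OF Cons.prems True]
        invol_inv_act[OF Cons.prems, of i]
      by (simp add: U_def Cons.prems)
  next
    case False
    then have "descend z i = z"
      by (simp add: descend_def)
    then show ?thesis
      using False dlen_foldl_descend[OF Cons.prems, of "is"]
      by (simp add: U_def Cons.prems)
  qed
qed auto

lemma foldr_U_cong:
  assumes "\<And>z. invol z \<Longrightarrow> foldl descend z is = foldl descend z js" "length is = length js" "is \<noteq> []"
  shows "foldr U is v = foldr U js v"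
proof
  fix z
  have "foldr U is v z = 0" "foldr U js v z = 0" if "\<not> invol z"
    using assms(2,3) that by (cases "is"; cases js; simp add: U_def)+
  then show "foldr U is v z = foldr U js v z"
    using assms(1)[of z] assms(2) by (cases "invol z") (simp_all add: foldr_U)
qed

lemma U_nil: "U i (U i v) = (\<lambda>_. 0)"
  by (rule ext) (auto simp: U_def inv_act_greater dest: order_less_asym)

lemma U_commute:
  assumes "Suc i < j"
  shows "U i (U j v) = U j (U i v)"
  using foldr_U_cong[of "[i, j]" "[j, i]" v] descend_commute[OF _ assms] by simp

lemma U_braid: "U i (U (Suc i) (U i v)) = U (Suc i) (U i (U (Suc i) v))"
  using foldr_U_cong[of "[i, Suc i, i]" "[Suc i, i, Suc i]" v] descend_braid by simp

lemma U_add: "U i (\<lambda>z. f z + g z) = (\<lambda>z. U i f z + U i g z)"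
  by (rule ext) (simp add: U_def)

lemma U_scale: "U i (\<lambda>z. c * f z) = (\<lambda>z. c * U i f z)"
  by (rule ext) (simp add: U_def)

lemma U_zero: "U i (\<lambda>z. 0) = (\<lambda>z. 0)"
  by (rule ext) (simp add: U_def)

section \<open>One-parameter factors and the Yang-Baxter equation\<close>

definition E :: "nat \<Rightarrow> 'r \<Rightarrow> 'r vec \<Rightarrow> ('r::comm_ring_1) vec" where
  "E i x v = (\<lambda>z. v z + x * U i v z)"

lemma U_E: "U i (E j x v) = (\<lambda>z. U i v z + x * U i (U j v) z)"
  by (simp add: E_def U_add U_scale)

lemma E_0 [simp]: "E i 0 v = v"
  by (simp add: E_def)

text \<open>Since \<open>U i\<close> squares to zero, the factors for one i form a one-parameter
  group; in particular \<open>E i (- x)\<close> inverts \<open>E i x\<close>.\<close>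

lemma E_E: "E i x (E i y v) = E i (x + y) v"
  by (simp add: E_def[of i x] E_def[of i "x + y"] U_E U_nil) (simp add: E_def algebra_simps)

lemma U_E_same: "U i (E i x v) = U i v"
  by (simp add: U_E U_nil)

lemma U_E_commute:
  assumes "Suc i < j \<or> Suc j < i"
  shows "U i (E j y v) = E j y (U i v)"
proof -
  have "U i (U j v) = U j (U i v)"
    using assms U_commute[of i j v] U_commute[of j i v] by argo
  then show ?thesis
    unfolding U_E by (simp add: E_def)
qed

lemma E_commute:
  assumes "Suc i < j \<or> Suc j < i"
  shows "E i x (E j y v) = E j y (E i x v)"
  unfolding E_def[of i x] U_E_commute[OF assms]
  by (simp add: E_def U_add U_scale algebra_simps)

text \<open>Expand both sides in the operators: the cubic terms agree by the braid relation, and the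
  extra terms in \<open>U i\<close> twice in a row vanish.\<close>

lemma E_yang_baxter:
  "E i x (E (Suc i) (x + y) (E i y v)) = E (Suc i) y (E i (x + y) (E (Suc i) x v))"
  by (rule ext) (simp add: E_def U_add U_scale U_nil U_zero U_braid algebra_simps)

section \<open>Factorisation of the generating operator\<close>

definition desc :: "nat \<Rightarrow> nat \<Rightarrow> 'r \<Rightarrow> 'r vec \<Rightarrow> ('r::comm_ring_1) vec" where
  "desc N k x v = foldr (\<lambda>j. E j x) [k..<N] v"

text \<open>The parameter varies with j because peeling off a variable produces the factors
  \<open>1 + (x_k + x_j) u_j\<close>.\<close>

definition asc :: "nat \<Rightarrow> nat \<Rightarrow> (nat \<Rightarrow> 'r) \<Rightarrow> 'r vec \<Rightarrow> ('r::comm_ring_1) vec" where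
  "asc N k x v = fold (\<lambda>j. E j (x j)) [k..<N] v"

text \<open>With operators acting from the right, this is the Fomin--Stanley product
  \<open>v A\<^sub>k(x\<^sub>k) A\<^sub>k\<^sub>+\<^sub>1(x\<^sub>k\<^sub>+\<^sub>1) \<cdots> A\<^sub>N\<^sub>-\<^sub>1(x\<^sub>N\<^sub>-\<^sub>1)\<close> where
  \<open>A\<^sub>i(x) = (1 + x u\<^sub>N\<^sub>-\<^sub>1) \<cdots> (1 + x u\<^sub>i)\<close>.\<close>

definition schub :: "nat \<Rightarrow> nat \<Rightarrow> (nat \<Rightarrow> 'r) \<Rightarrow> 'r vec \<Rightarrow> ('r::comm_ring_1) vec" where
  "schub N k x v = fold (\<lambda>i. desc N i (x i)) [k..<N] v"

lemma desc_rec: "desc N k x v = (if k < N then E k x (desc N (Suc k) x v) else v)"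
  by (simp add: desc_def upt_rec)

lemma asc_rec: "asc N k x v = (if k < N then asc N (Suc k) x (E k (x k) v) else v)"
  by (simp add: asc_def upt_rec)

lemma schub_rec: "schub N k x v = (if k < N then schub N (Suc k) x (desc N k (x k) v) else v)"
  by (simp add: schub_def upt_rec)

lemma desc_Suc: "k < N \<Longrightarrow> desc N (Suc k) x v = E k (- x) (desc N k x v)"
  by (simp add: desc_rec[of N k] E_E)

lemma foldr_commute:
  "(\<And>x w. x \<in> set xs \<Longrightarrow> f (g x w) = g x (f w)) \<Longrightarrow> f (foldr g xs v) = foldr g xs (f v)"
  by (induction xs) auto

lemma fold_commute_arg:
  "(\<And>x w. x \<in> set xs \<Longrightarrow> f (g x w) = g x (f w)) \<Longrightarrow> f (fold g xs v) = fold g xs (f v)"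
  by (induction xs arbitrary: v) auto

lemma E_desc: "Suc i < k \<Longrightarrow> E i y (desc N k x v) = desc N k x (E i y v)"
  unfolding desc_def by (rule foldr_commute) (simp add: E_commute)

lemma E_asc: "Suc i < k \<Longrightarrow> E i y (asc N k x v) = asc N k x (E i y v)"
  unfolding asc_def by (rule fold_commute_arg) (simp add: E_commute)

lemma E_schub: "Suc i < k \<Longrightarrow> E i y (schub N k x v) = schub N k x (E i y v)"
  unfolding schub_def by (rule fold_commute_arg) (simp add: E_desc)

lemma U_desc: "Suc i < k \<Longrightarrow> U i (desc N k x v) = desc N k x (U i v)"
  unfolding desc_def by (rule foldr_commute) (simp add: U_E_commute)

lemma U_schub: "Suc i < k \<Longrightarrow> U i (schub N k x v) = schub N k x (U i v)"
  unfolding schub_def by (rule fold_commute_arg) (simp add: U_desc)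

text \<open>Downward induction on k: both products are expressed through the product for k+1, which
  is symmetric by hypothesis, and the remaining factors at k and k+1 are matched by
  Yang-Baxter.\<close>

lemma desc_commute: "desc N k y (desc N k x v) = desc N k x (desc N k y v)"
proof (induction "N - k" arbitrary: k)
  case 0
  then show ?case
    by (simp add: desc_rec)
next
  case (Suc m)
  then have k: "k < N" by simp
  show ?case
  proof (cases "Suc k < N")
    case False
    then show ?thesis
      using k by (simp add: desc_rec[of N k] desc_rec[of N "Suc k"] E_E add.commute)
  next
    case True
    have IH: "desc N (Suc k) y (desc N (Suc k) x v) = desc N (Suc k) x (desc N (Suc k) y v)"
      using Suc by simp
    have expand: "desc N k y (desc N k x v) =
        E k y (E (Suc k) y (E k x (E (Suc k) (- y) (desc N (Suc k) y (desc N (Suc k) x v)))))" for x y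
    proof -
      have "desc N k y (desc N k x v) =
          E k y (E (Suc k) y (desc N (Suc (Suc k)) y (E k x (desc N (Suc k) x v))))"
        using k True by (simp add: desc_rec[of N k] desc_rec[of N "Suc k" y])
      also have "\<dots> = E k y (E (Suc k) y (E k x (desc N (Suc (Suc k)) y (desc N (Suc k) x v))))"
        by (simp add: E_desc)
      finally show ?thesis
        using True by (simp add: desc_Suc)
    qed
    define M where "M = desc N (Suc k) y (desc N (Suc k) x v)"
    \<comment> \<open>Splitting \<open>E k y\<close> as \<open>E k x\<close> after
      \<open>E k (y - x)\<close> creates the parameter pattern y-x, y, x required by
      Yang-Baxter.\<close>
    have "desc N k y (desc N k x v) =
        E k x (E k (y - x) (E (Suc k) (y - x + x) (E k x (E (Suc k) (- y) M))))"
      unfolding expand M_def[symmetric] by (simp add: E_E)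
    also have "\<dots> = E k x (E (Suc k) x (E k y (E (Suc k) (y - x) (E (Suc k) (- y) M))))"
      unfolding E_yang_baxter by simp
    also have "\<dots> = E k x (E (Suc k) x (E k y (E (Suc k) (- x) M)))"
      by (simp add: E_E)
    also have "\<dots> = desc N k x (desc N k y v)"
      unfolding expand M_def IH ..
    finally show ?thesis .
  qed
qed

text \<open>The two terms are \<open>E k (- y) M\<close> and \<open>E k (- x) M\<close> for the same
  symmetric M, and applying \<open>U k\<close> erases a factor \<open>E k\<close>.\<close>

lemma desc_diff:
  assumes "k < N"
  shows "desc N (Suc k) y (desc N k x w) z - desc N (Suc k) x (desc N k y w) z =
    (x - y) * U k (desc N (Suc k) y (desc N k x w)) z"
proof -
  define M where "M = desc N k y (desc N k x w)"
  have *: "desc N (Suc k) y (desc N k x w) = E k (- y) M" "desc N (Suc k) x (desc N k y w) = E k (- x) M"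
    using assms by (simp_all add: M_def desc_Suc desc_commute[of N k x y])
  show ?thesis
    unfolding * U_E_same by (simp add: E_def algebra_simps)
qed

lemma E_scale: "E i x (\<lambda>z. c * f z) = (\<lambda>z. c * E i x f z)"
  by (simp add: E_def U_scale algebra_simps)

lemma E_minus: "E i x (\<lambda>z. f z - g z) = (\<lambda>z. E i x f z - E i x g z)"
  by (rule ext) (simp add: E_def U_def algebra_simps)

lemma desc_scale: "desc N k x (\<lambda>z. c * f z) = (\<lambda>z. c * desc N k x f z)"
proof -
  have "foldr (\<lambda>j. E j x) js (\<lambda>z. c * f z) = (\<lambda>z. c * foldr (\<lambda>j. E j x) js f z)" for js
    by (induction js) (simp_all add: E_scale)
  then show ?thesis
    by (simp add: desc_def)
qed

lemma desc_minus: "desc N k x (\<lambda>z. f z - g z) = (\<lambda>z. desc N k x f z - desc N k x g z)"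
proof -
  have "foldr (\<lambda>j. E j x) js (\<lambda>z. f z - g z) =
      (\<lambda>z. foldr (\<lambda>j. E j x) js f z - foldr (\<lambda>j. E j x) js g z)" for js
    by (induction js) (simp_all add: E_minus)
  then show ?thesis
    by (simp add: desc_def)
qed

lemma schub_scale: "schub N k x (\<lambda>z. c * f z) = (\<lambda>z. c * schub N k x f z)"
proof -
  have "fold (\<lambda>i. desc N i (x i)) js (\<lambda>z. c * f z) = (\<lambda>z. c * fold (\<lambda>i. desc N i (x i)) js f z)" for js
    by (induction js arbitrary: f) (simp_all add: desc_scale)
  then show ?thesis
    by (simp add: schub_def)
qed

lemma schub_minus: "schub N k x (\<lambda>z. f z - g z) = (\<lambda>z. schub N k x f z - schub N k x g z)"
proof -
  have "fold (\<lambda>i. desc N i (x i)) js (\<lambda>z. f z - g z) =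
      (\<lambda>z. fold (\<lambda>i. desc N i (x i)) js f z - fold (\<lambda>i. desc N i (x i)) js g z)" for js
    by (induction js arbitrary: f g) (simp_all add: desc_minus)
  then show ?thesis
    by (simp add: schub_def)
qed

text \<open>The divided difference rule. Factors before i do not see the exchange, the two factors
  at i and i+1 are handled by \<open>desc_diff\<close>, and all later factors use letters beyond
  i+1, so they commute with \<open>U i\<close>.\<close>

lemma schub_diff:
  assumes "k \<le> i" "Suc i < N"
    and swap: "x' = x(i := x (Suc i), Suc i := x i)"
  shows "schub N k x v z - schub N k x' v z = (x i - x (Suc i)) * U i (schub N k x v) z"
proof -
  define w where "w = fold (\<lambda>j. desc N j (x j)) [k..<i] v"
  have w': "w = fold (\<lambda>j. desc N j (x' j)) [k..<i] v"
    unfolding w_def by (rule fold_cong) (auto simp: swap)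
  have split: "[k..<N] = [k..<i] @ i # Suc i # [Suc (Suc i)..<N]"
    using assms upt_add_eq_append[of k i "N - i"] by (simp add: upt_conv_Cons)
  have x: "schub N k x v = schub N (Suc (Suc i)) x (desc N (Suc i) (x (Suc i)) (desc N i (x i) w))"
    by (simp add: schub_def split w_def)
  have rest: "schub N (Suc (Suc i)) x' = schub N (Suc (Suc i)) x"
    unfolding schub_def by (intro ext fold_cong) (auto simp: swap)
  have x': "schub N k x' v = schub N (Suc (Suc i)) x (desc N (Suc i) (x i) (desc N i (x (Suc i)) w))"
    unfolding rest[symmetric] by (simp add: schub_def split w') (simp add: swap)
  have "schub N k x v z - schub N k x' v z = schub N (Suc (Suc i)) x
      (\<lambda>z. desc N (Suc i) (x (Suc i)) (desc N i (x i) w) z - desc N (Suc i) (x i) (desc N i (x (Suc i)) w) z) z"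
    unfolding x x' schub_minus ..
  also have "\<dots> = (x i - x (Suc i)) * U i (schub N k x v) z"
    using \<open>Suc i < N\<close> by (simp add: desc_diff schub_scale x U_schub)
  finally show ?thesis .
qed

text \<open>A descending product passes an ascending one by repeated Yang-Baxter moves, each moving
  the factor with the summed parameter x+y one letter down; in the end it sits at k.\<close>

lemma desc_asc:
  assumes "k < N"
  shows "desc N k x (asc N k (\<lambda>_. y) v) = asc N (Suc k) (\<lambda>_. y) (E k (x + y) (desc N (Suc k) x v))"
  using assms
proof (induction "N - k" arbitrary: k v)
  case (Suc m)
  show ?case
  proof (cases "Suc k < N")
    case False
    then show ?thesis
      using Suc.prems by (simp add: desc_rec[of N k] desc_rec[of N "Suc k"] asc_rec[of N k] asc_rec[of N "Suc k"] E_E)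
  next
    case True
    have IH: "desc N (Suc k) x (asc N (Suc k) (\<lambda>_. y) w) =
        asc N (Suc (Suc k)) (\<lambda>_. y) (E (Suc k) (x + y) (desc N (Suc (Suc k)) x w))" for w
      using Suc.hyps True by simp
    have "desc N k x (asc N k (\<lambda>_. y) v) =
        asc N (Suc (Suc k)) (\<lambda>_. y) (E k x (E (Suc k) (x + y) (E k y (desc N (Suc (Suc k)) x v))))"
      using Suc.prems by (simp add: desc_rec[of N k] asc_rec[of N k] IH E_asc E_desc)
    also have "\<dots> = asc N (Suc k) (\<lambda>_. y) (E k (x + y) (desc N (Suc k) x v))"
      using True by (simp add: E_yang_baxter asc_rec[of N "Suc k"] desc_rec[of N "Suc k"])
    finally show ?thesis .
  qed
qed simp

text \<open>Each \<open>desc\<close> passing the ascending product loses its lowest letter. The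
  factor carrying \<open>x j\<close> then starts at j+1, whence the index j-1 on the right.\<close>

lemma schub_asc:
  "schub N k x (asc N k (\<lambda>_. y) v) = asc N k (\<lambda>j. y + x j) (schub N (Suc k) (\<lambda>j. x (j - 1)) v)"
proof (induction "N - k" arbitrary: k v)
  case 0
  then show ?case
    by (simp add: schub_rec asc_rec)
next
  case (Suc m)
  then have k: "k < N" by simp
  have "schub N k x (asc N k (\<lambda>_. y) v) =
      schub N (Suc k) x (asc N (Suc k) (\<lambda>_. y) (E k (y + x k) (desc N (Suc k) (x k) v)))"
    using k by (simp add: schub_rec[of N k] desc_asc add.commute)
  also have "\<dots> = asc N (Suc k) (\<lambda>j. y + x j)
      (schub N (Suc (Suc k)) (\<lambda>j. x (j - 1)) (E k (y + x k) (desc N (Suc k) (x k) v)))"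
    using Suc.hyps by simp
  also have "\<dots> = asc N k (\<lambda>j. y + x j) (schub N (Suc (Suc k)) (\<lambda>j. x (j - 1)) (desc N (Suc k) (x k) v))"
    using k by (simp add: E_schub[symmetric] asc_rec[of N k])
  \<comment> \<open>The shifted product over k+1, ... begins with the factor carrying
    \<open>x k\<close>; for Suc k = N both sides are v.\<close>
  also have "schub N (Suc (Suc k)) (\<lambda>j. x (j - 1)) (desc N (Suc k) (x k) v) = schub N (Suc k) (\<lambda>j. x (j - 1)) v"
    by (cases "Suc k < N") (simp_all add: schub_rec[of N "Suc k"] schub_rec[of N "Suc (Suc k)"] desc_rec[of N "Suc k"])
  finally show ?case .
qed

text \<open>The boundary condition \<open>v A\<^sub>k(x) A\<^sub>k(-x) = v\<close> peels off the first variable.\<close>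

lemma schub_boundary:
  assumes "k < N" and boundary: "desc N k (x k) v = asc N k (\<lambda>_. x k) v"
  shows "schub N k x v =
    asc N (Suc k) (\<lambda>j. x k + x j) (E k (x k) (schub N (Suc (Suc k)) (\<lambda>j. x (j - 1)) v))"
proof -
  have "schub N k x v = schub N (Suc k) x (asc N (Suc k) (\<lambda>_. x k) (E k (x k) v))"
    using assms by (simp add: schub_rec[of N k] asc_rec[of N k])
  then show ?thesis
    by (simp add: schub_asc E_schub)
qed

text \<open>The boundary condition for the identity: only neighbouring letters could obstruct
  reversing the product, and on v they commute.\<close>

lemma desc_eq_asc_if_commuting:
  assumes "\<And>i. U (Suc i) (U i v) = U i (U (Suc i) v)"
  shows "desc N k x v = asc N k (\<lambda>_. x) v"
proof -
  have E: "E (Suc i) x (E i x v) = E i x (E (Suc i) x v)" for i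
    by (rule ext) (simp add: E_def U_add U_scale assms algebra_simps)
  show ?thesis
  proof (induction "N - k" arbitrary: k)
    case 0
    then show ?case
      by (simp add: desc_rec asc_rec)
  next
    case (Suc m)
    then have k: "k < N" by simp
    have IH: "desc N (Suc k) x v = asc N (Suc k) (\<lambda>_. x) v"
      using Suc by simp
    show ?case
      using k by (cases "Suc k < N")
        (simp_all add: desc_rec[of N k] IH asc_rec[of N k] asc_rec[of N "Suc k"] E_asc E)
  qed
qed

text \<open>The boundary condition for \<open>fpf_base\<close>. Odd letters next to v disappear, and
  after an even letter its two odd neighbours act alike, so the product is reversed two letters at a
  time.\<close>

lemma desc_eq_asc_if_fpf:
  assumes odd: "\<And>i. odd i \<Longrightarrow> i < N \<Longrightarrow> U i v = (\<lambda>_. 0)"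
    and even: "\<And>i. even i \<Longrightarrow> 0 < i \<Longrightarrow> i < N \<Longrightarrow> U (i - 1) (U i v) = U (Suc i) (U i v)"
    and "even N" "odd k"
  shows "desc N k x v = asc N k (\<lambda>_. x) v"
  using \<open>odd k\<close>
proof (induction "N - k" arbitrary: k rule: less_induct)
  case less
  have E_odd: "E i y v = v" if "odd i" "i < N" for i y
    using odd[OF that] by (simp add: E_def)
  \<comment> \<open>Parity excludes N = k+2, so beyond the short cases the letters k, k+1 and k+2
    are all below N.\<close>
  consider "N \<le> k" | "N = Suc k" | "Suc (Suc k) < N"
    using \<open>even N\<close> \<open>odd k\<close> by (metis even_Suc le_less_Suc_eq less_Suc_eq_le nat_less_le not_le_imp_less)
  then show ?case
  proof cases
    case 3
    have IH: "desc N (Suc (Suc k)) x v = asc N (Suc (Suc k)) (\<lambda>_. x) v"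
      using less.hyps[of "Suc (Suc k)"] less.prems 3 by simp
    have odd': "U k v = (\<lambda>_. 0)" "U (Suc (Suc k)) v = (\<lambda>_. 0)"
      using odd[of k] odd[of "Suc (Suc k)"] less.prems 3 by auto
    have "U k (U (Suc k) v) = U (Suc (Suc k)) (U (Suc k) v)"
      using even[of "Suc k"] less.prems 3 by simp
    then have E: "E k x (E (Suc k) x v) = E (Suc (Suc k)) x (E (Suc k) x v)"
      unfolding E_def[of k] E_def[of "Suc (Suc k)"] by (simp add: U_E odd')
    have "desc N k x v = E k x (E (Suc k) x (asc N (Suc (Suc k)) (\<lambda>_. x) v))"
      using 3 by (simp add: desc_rec[of N k] desc_rec[of N "Suc k"] IH)
    also have "\<dots> = E k x (E (Suc k) x (asc N (Suc (Suc (Suc k))) (\<lambda>_. x) v))"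
      using 3 less.prems by (simp add: asc_rec[of N "Suc (Suc k)"] E_odd)
    also have "\<dots> = asc N (Suc (Suc (Suc k))) (\<lambda>_. x) (E (Suc (Suc k)) x (E (Suc k) x v))"
      by (simp add: E_asc E)
    also have "\<dots> = asc N k (\<lambda>_. x) v"
      using 3 less.prems by (simp add: asc_rec[of N k] asc_rec[of N "Suc k"] asc_rec[of N "Suc (Suc k)"] E_odd)
    finally show ?thesis .
  qed (simp_all add: desc_def asc_def)
qed

section \<open>The top coefficient\<close>

definition flip :: "(nat \<Rightarrow> nat) \<Rightarrow> nat \<Rightarrow> nat \<Rightarrow> nat \<Rightarrow> nat" where
  "flip y N k i = (if k \<le> i \<and> i \<le> N then k + N - i else y i)"

text \<open>The conjugate of \<open>flip y N k\<close> by the cycle \<open>N \<mapsto> j \<mapsto> j + 1 \<mapsto> \<cdots> \<mapsto> N\<close>, so that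
  \<open>k\<close> is matched with \<open>j\<close>.\<close>

definition flip_conj :: "(nat \<Rightarrow> nat) \<Rightarrow> nat \<Rightarrow> nat \<Rightarrow> nat \<Rightarrow> nat \<Rightarrow> nat" where
  "flip_conj y N k j i =
     (let r = flip y N k (if i = j then N else if j < i \<and> i \<le> N then i - 1 else i)
      in if r = N then j else if j \<le> r \<and> r < N then r + 1 else r)"

text \<open>The situation after some peeling: positions below k are closed under y and out of reach
  of the remaining letters, and the block from k to N is to be reversed.\<close>

locale partial_flip =
  fixes y :: "nat \<Rightarrow> nat" and N k :: nat
  assumes invol_y: "invol y"
    and y_less: "i < k \<Longrightarrow> y i < k"
    and y_greater: "N < i \<Longrightarrow> y i = i"
    and k_less: "k < N"
begin

lemma y_apply: "y (y i) = i"
  by (rule invol_apply[OF invol_y])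

lemma flip_conj_N: "flip_conj y N k N = flip y N k"
  using y_less y_greater k_less by (auto simp: flip_conj_def flip_def fun_eq_iff Let_def)

lemma flip_flip: "flip y N k (flip y N k i) = i"
  using y_less[of i] y_greater[of i] y_apply k_less by (auto simp: flip_def)

lemma flip_conj_k: "k < j \<Longrightarrow> j \<le> N \<Longrightarrow> flip_conj y N k j k = j"
  using k_less by (auto simp: flip_conj_def flip_def Let_def)

lemma flip_conj_j: "k < j \<Longrightarrow> j \<le> N \<Longrightarrow> flip_conj y N k j j = k"
  using k_less by (auto simp: flip_conj_def flip_def Let_def)

lemma invol_flip_conj:
  assumes "k < j" "j \<le> N"
  shows "invol (flip_conj y N k j)"
proof -
  define c d where "c i = (if i = j then N else if j < i \<and> i \<le> N then i - 1 else i)"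
    and "d r = (if r = N then j else if j \<le> r \<and> r < N then r + 1 else r)" for i r
  have cd: "c (d i) = i" "d (c i) = i" for i
    using assms by (auto simp: c_def d_def)
  have eq: "flip_conj y N k j i = d (flip y N k (c i))" for i
    by (simp add: flip_conj_def c_def d_def Let_def)
  have "flip_conj y N k j i = i" if "N < i" for i
    using that assms y_greater[OF that] by (simp add: eq c_def d_def flip_def)
  then have "{i. flip_conj y N k j i \<noteq> i} \<subseteq> {..N}"
    by (intro subsetI) (metis (mono_tags) atMost_iff linorder_not_le mem_Collect_eq)
  then have "finite {i. flip_conj y N k j i \<noteq> i}"
    by (rule finite_subset) simp
  moreover have "flip_conj y N k j (flip_conj y N k j i) = i" for i
    by (simp only: eq cd flip_flip)
  ultimately show ?thesis
    by (simp add: invol_def)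
qed

lemma flip_conj_descent:
  assumes "k < j" "j < N"
  shows "k < flip_conj y N k (Suc j) j"
  using assms by (auto simp: flip_conj_def flip_def Let_def)

text \<open>Removing the descents N-1, ..., k+1 in turn leads from \<open>flip y N k\<close> down to
  \<open>flip_conj y N k (Suc k)\<close>, lowering the partner of k by one each time.\<close>

lemma inv_act_flip_conj:
  assumes "k < j" "j < N"
  shows "inv_act (flip_conj y N k (Suc j)) j = flip_conj y N k j"
proof
  fix i
  have "flip_conj y N k (Suc j) (Suc j) = k"
    using assms by (intro flip_conj_j) auto
  then have "inv_act (flip_conj y N k (Suc j)) j i =
      simple_refl j (flip_conj y N k (Suc j) (simple_refl j i))"
    using assms by (subst inv_act_apply) (auto intro: invol_flip_conj)
  also have "\<dots> = flip_conj y N k j i"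
  proof -
    have "(if simple_refl j i = Suc j then N else if Suc j < simple_refl j i \<and> simple_refl j i \<le> N
        then simple_refl j i - 1 else simple_refl j i) = (if i = j then N else if j < i \<and> i \<le> N then i - 1 else i)"
      using assms by (auto simp: simple_refl_apply)
    moreover have "simple_refl j (if r = N then Suc j else if Suc j \<le> r \<and> r < N then r + 1 else r) =
        (if r = N then j else if j \<le> r \<and> r < N then r + 1 else r)" for r
      using assms by (auto simp: simple_refl_apply)
    ultimately show ?thesis
      by (simp only: flip_conj_def Let_def)
  qed
  finally show "inv_act (flip_conj y N k (Suc j)) j i = flip_conj y N k j i" .
qed

lemma flip_conj_Suc:
  "flip_conj y N k (Suc k) i =
    (if i = k then Suc k else if i = Suc k then k else flip y N (Suc (Suc k)) i)"
proof -
  consider "i < k" | "i = k" | "i = Suc k" | "Suc k < i" "i \<le> N" | "N < i"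
    by linarith
  then show ?thesis
  proof cases
    case 1
    then have "y i < k" by (rule y_less)
    with 1 k_less show ?thesis
      by (simp add: flip_conj_def flip_def Let_def)
  next
    case 5
    then have "y i = i" by (rule y_greater)
    with 5 k_less show ?thesis
      by (simp add: flip_conj_def flip_def Let_def)
  qed (use k_less in \<open>auto simp: flip_conj_def flip_def Let_def\<close>)
qed

end

text \<open>A letter m beyond k fixes position k and can raise its value only from m to m+1.\<close>

lemma asc_support:
  assumes "\<And>z. invol z \<Longrightarrow> v z \<noteq> 0 \<Longrightarrow> z k \<le> j" "k < j"
    and "invol z" "asc m j c v z \<noteq> 0" "j \<le> m"
  shows "z k \<le> m"
  using assms(5,1-4)
proof (induction m arbitrary: z rule: dec_induct)
  case base
  then show ?case by (simp add: asc_def)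
next
  case (step m)
  have "asc (Suc m) j c v = E m (c m) (asc m j c v)"
    using step.hyps by (simp add: asc_def)
  then have "asc m j c v z + c m * U m (asc m j c v) z \<noteq> 0"
    using step.prems by (simp add: E_def)
  then consider "asc m j c v z \<noteq> 0" | "U m (asc m j c v) z \<noteq> 0"
    by fastforce
  then show ?case
  proof cases
    case 1
    then have "z k \<le> m"
      using step.IH step.prems by blast
    then show ?thesis by simp
  next
    case 2
    define q where "q = inv_act z m"
    have q: "invol q" "inv_act q m = z"
      by (simp_all add: q_def invol_inv_act inv_act_inv_act step.prems)
    have "asc m j c v q \<noteq> 0"
      using 2 by (auto simp: U_def q_def split: if_splits)
    then have "q k \<le> m"
      using step.IH step.prems q by blast
    moreover have "simple_refl m k = k"
      using step.hyps step.prems by simp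
    ultimately show ?thesis
      using q inv_act_apply[OF q(1), of m k] by (auto simp: simple_refl_apply split: if_splits)
  qed
qed

text \<open>The target sends k to m+1, which is out of reach before letter m is used. So the
  identity term of each factor contributes nothing and every parameter is collected exactly
  once.\<close>

lemma (in partial_flip) asc_flip_conj:
  fixes v :: "'r::comm_ring_1 vec"
  assumes supp: "\<And>z. invol z \<Longrightarrow> v z \<noteq> 0 \<Longrightarrow> z k \<le> Suc k" and "Suc k \<le> m" "m \<le> N"
  shows "asc m (Suc k) c v (flip_conj y N k m) = (\<Prod>j = Suc k..<m. c j) * v (flip_conj y N k (Suc k))"
  using assms(2,3)
proof (induction m rule: dec_induct)
  case base
  then show ?case by (simp add: asc_def)
next
  case (step m)
  let ?w = "asc m (Suc k) c v" and ?z = "flip_conj y N k (Suc m)"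
  have invol: "invol ?z"
    using step by (intro invol_flip_conj) auto
  have zk: "?z k = Suc m" "?z (Suc m) = k"
    using step by (simp_all add: flip_conj_k flip_conj_j)
  have "?w ?z = 0"
    using asc_support[of v k "Suc k" ?z m c] supp invol zk step.hyps by fastforce
  moreover have "U m ?w ?z = ?w (flip_conj y N k m)"
    using invol zk step flip_conj_descent[of m] inv_act_flip_conj[of m] by (simp add: U_def)
  moreover have "asc (Suc m) (Suc k) c v ?z = ?w ?z + c m * U m ?w ?z"
    using step.hyps by (simp add: asc_def E_def)
  ultimately show ?case
    using step by (simp add: algebra_simps)
qed

text \<open>Letters from k on fix the positions below k, and also the values there, since y keeps
  these below k.\<close>

lemma schub_support:
  assumes "\<And>z. invol z \<Longrightarrow> v z \<noteq> 0 \<Longrightarrow> \<forall>i<k. z i = y i" and "\<And>i. i < k \<Longrightarrow> y i < k"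
    and "invol z" "schub N k x v z \<noteq> 0"
  shows "\<forall>i<k. z i = y i"
proof -
  define P :: "'a vec \<Rightarrow> bool" where "P v \<longleftrightarrow> (\<forall>z. invol z \<longrightarrow> v z \<noteq> 0 \<longrightarrow> (\<forall>i<k. z i = y i))" for v
  have E: "P (E j x v)" if "P v" "k \<le> j" for v x j
    unfolding P_def
  proof (intro allI impI)
    fix z i assume z: "invol z" "E j x v z \<noteq> 0" and i: "i < k"
    then consider "v z \<noteq> 0" | "U j v z \<noteq> 0"
      by (fastforce simp: E_def)
    then show "z i = y i"
    proof cases
      case 2
      define q where "q = inv_act z j"
      have q: "invol q" "inv_act q j = z"
        by (simp_all add: q_def invol_inv_act inv_act_inv_act z)
      have "v q \<noteq> 0"
        using 2 by (auto simp: U_def q_def split: if_splits)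
      then have "q i = y i"
        using that q i by (auto simp: P_def)
      moreover have "y i < k"
        using assms(2) i .
      ultimately show ?thesis
        using q inv_act_apply[OF q(1), of j i] i \<open>k \<le> j\<close> by (auto simp: simple_refl_apply)
    qed (use that z i in \<open>auto simp: P_def\<close>)
  qed
  have desc: "P (desc N i x v)" if "P v" "k \<le> i" for v x i
  proof -
    have "P (foldr (\<lambda>j. E j x) js v)" if "\<forall>j\<in>set js. k \<le> j" for js
      using that \<open>P v\<close> by (induction js) (auto intro: E)
    then show ?thesis
      using \<open>k \<le> i\<close> by (simp add: desc_def)
  qed
  have fold: "P (fold (\<lambda>i. desc N i (x i)) js v)" if "\<forall>j\<in>set js. k \<le> j" "P v" for js v
    using that by (induction js arbitrary: v) (auto intro: desc)
  have "P v"
    using assms(1) by (simp add: P_def)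
  then have "P (schub N k x v)"
    unfolding schub_def by (intro fold) auto
  then show ?thesis
    using assms by (auto simp: P_def)
qed

definition delta :: "(nat \<Rightarrow> nat) \<Rightarrow> ('r::comm_ring_1) vec" where
  "delta y z = (if z = y then 1 else 0)"

lemma inv_act_eq_iff: "invol z \<Longrightarrow> invol y \<Longrightarrow> inv_act z i = y \<longleftrightarrow> z = inv_act y i"
  using inv_act_inv_act by metis

lemma U_delta:
  assumes "invol y"
  shows "U i (delta y) = (if y i < y (Suc i) then delta (inv_act y i) else (\<lambda>_. 0))"
proof
  fix z
  show "U i (delta y) z = (if y i < y (Suc i) then delta (inv_act y i) else (\<lambda>_. 0)) z"
    using inv_act_eq_iff[OF _ assms, of z i] inv_act_greater[OF assms, of i] invol_inv_act[OF assms, of i]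
      inv_act_less[of z i]
    by (auto simp: U_def delta_def inv_act_inv_act[OF assms])
qed

text \<open>\<open>schub_boundary\<close> leaves an ascending product, whose parameters are all
  collected by \<open>asc_flip_conj\<close>, and one factor at k. If y fixes k, that factor must
  supply u_k and hence \<open>x k\<close>; if y already pairs k with k+1, it must act as the
  identity.\<close>

lemma schub_top_peel:
  assumes y: "invol y" "\<And>i. i < k \<Longrightarrow> y i < k" "\<And>i. N < i \<Longrightarrow> y i = i"
    and yk: "y k = k \<and> y (Suc k) = Suc k \<or> y k = Suc k \<and> y (Suc k) = k"
    and k: "k < N"
    and boundary: "desc N k (x k) (delta y) = asc N k (\<lambda>_. x k) (delta y)"
  shows "schub N k x (delta y) (flip y N k) = (if y k = k then x k else 1) *
    (\<Prod>j = Suc k..<N. x k + x j) *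
    schub N (Suc (Suc k)) (\<lambda>j. x (j - 1)) (delta y) (flip y N (Suc (Suc k)))"
proof -
  interpret partial_flip y N k
    using y k by unfold_locales auto
  define s where "s = schub N (Suc (Suc k)) (\<lambda>j. x (j - 1)) (delta y)"
  define v where "v = E k (x k) s"
  have less: "i < Suc (Suc k) \<Longrightarrow> y i < Suc (Suc k)" for i
    using y(2)[of i] yk by (cases "i < k"; cases "i = k") (auto simp: not_less less_Suc_eq)
  have s_supp: "z i = y i" if "invol z" "s z \<noteq> 0" "i < Suc (Suc k)" for z i
  proof -
    have "\<forall>i<Suc (Suc k). z i = y i"
    proof (rule schub_support[where v = "delta y" and N = N and x = "\<lambda>j. x (j - 1)"])
      show "\<forall>i<Suc (Suc k). w i = y i" if "delta y w \<noteq> (0::'a)" for w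
        using that by (simp add: delta_def split: if_splits)
    qed (use less that s_def in simp_all)
    with that(3) show ?thesis
      by blast
  qed
  have U_supp: "y k = k \<and> z k = Suc k" if "invol z" "U k s z \<noteq> 0" for z
  proof -
    define q where "q = inv_act z k"
    have q: "invol q" "inv_act q k = z"
      by (simp_all add: q_def invol_inv_act inv_act_inv_act that)
    have "s q \<noteq> 0" and d: "z (Suc k) < z k"
      using that by (auto simp: U_def q_def split: if_splits)
    then have qy: "q k = y k" "q (Suc k) = y (Suc k)"
      using s_supp q by auto
    have "q k < q (Suc k)"
      using d inv_act_greater[OF q(1), of k] q by simp
    then have "y k = k" "y (Suc k) = Suc k"
      using yk qy by auto
    then show ?thesis
      using qy q(2)[symmetric] by (simp add: inv_act_apply[OF q(1)])
  qed
  have v_supp: "z k \<le> Suc k" if "invol z" "v z \<noteq> 0" for z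
  proof -
    have "s z \<noteq> 0 \<or> U k s z \<noteq> 0"
      using that(2) by (fastforce simp: v_def E_def)
    then show ?thesis
    proof
      assume "s z \<noteq> 0"
      then have "z k = y k"
        using s_supp that(1) by simp
      with yk show ?thesis
        by auto
    next
      assume "U k s z \<noteq> 0"
      then show ?thesis
        using U_supp that(1) by simp
    qed
  qed
  let ?z = "flip_conj y N k (Suc k)"
  have z: "invol ?z" "?z k = Suc k" "?z (Suc k) = k"
    using k by (auto simp: invol_flip_conj flip_conj_k flip_conj_j)
  have "v ?z = (if y k = k then x k else 1) * s (flip y N (Suc (Suc k)))"
  proof (cases "y k = k")
    case True
    have "s ?z = 0"
      using s_supp[of ?z k] z True by force
    moreover have "inv_act ?z k = flip y N (Suc (Suc k))"
      using True yk by (auto simp: fun_eq_iff inv_act_apply[OF z(1)] z(2,3) flip_conj_Suc simple_refl_apply flip_def)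
    ultimately show ?thesis
      using True z by (simp add: v_def E_def U_def)
  next
    case False
    have "U k s ?z = 0"
      using U_supp[of ?z] z False by blast
    moreover have "?z = flip y N (Suc (Suc k))"
      using False yk by (auto simp: fun_eq_iff flip_conj_Suc flip_def)
    ultimately show ?thesis
      using False by (simp add: v_def E_def)
  qed
  moreover have "schub N k x (delta y) (flip y N k) =
      (\<Prod>j = Suc k..<N. x k + x j) * v ?z"
    using asc_flip_conj[of v N "\<lambda>j. x k + x j"] v_supp k
    by (simp add: schub_boundary[of k N x, OF k boundary] flip_conj_N v_def s_def)
  ultimately show ?thesis
    by (simp add: s_def mult.commute mult.left_commute)
qed

section \<open>Expansion into involution words\<close>

lemma U_apply: "invol z \<Longrightarrow> U i v z = (if z (Suc i) < z i then v (inv_act z i) else 0)"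
  by (simp add: U_def)

lemma fold_U_delta:
  assumes "invol y" "invol z"
  shows "fold U a (delta y) z = (if asc_path y a \<and> foldl inv_act y a = z then 1 else (0::'r::comm_ring_1))"
  using assms(2)
proof (induction a arbitrary: z rule: rev_induct)
  case Nil
  then show ?case by (auto simp: delta_def)
next
  case (snoc i a)
  let ?q = "foldl inv_act y a"
  have q: "invol ?q"
    using assms(1) by (rule invol_foldl)
  have "fold U (a @ [i]) (delta y) z =
      (if z (Suc i) < z i \<and> asc_path y a \<and> ?q = inv_act z i then 1 else (0::'r))"
    using snoc.IH[OF invol_inv_act[OF snoc.prems]] by (simp add: U_apply[OF snoc.prems])
  also have "z (Suc i) < z i \<and> asc_path y a \<and> ?q = inv_act z i \<longleftrightarrow>
      asc_path y (a @ [i]) \<and> foldl inv_act y (a @ [i]) = z"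
    using inv_act_eq_iff[OF snoc.prems q, of i] inv_act_greater[OF q, of i]
    by (auto simp: asc_path_append inv_act_inv_act[OF q])
  finally show ?case .
qed

lemma fold_U_lin: "fold U a (\<lambda>z. f z + c * g z) z = fold U a f z + c * fold U a g z"
  by (induction a arbitrary: f g) (simp_all add: U_add U_scale)

lemma set_subseq: "subseq xs ys \<Longrightarrow> set xs \<subseteq> set ys"
  by (induction rule: list_emb.induct) auto

text \<open>Multiplying out, each factor is either skipped or used. Distinctness of L ensures that
  different choices are different lists, so the sum may run over a set.\<close>

lemma fold_E_subseqs:
  fixes x :: "nat \<Rightarrow> 'r::comm_ring_1"
  assumes "distinct L"
  shows "fold (\<lambda>(i, j). E j (x i)) L v z =
    (\<Sum>T\<in>set (subseqs L). prod_list (map (x \<circ> fst) T) * fold U (map snd T) v z)"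
  using assms
proof (induction L arbitrary: v)
  case (Cons p L)
  obtain i j where p: "p = (i, j)" by fastforce
  let ?f = "\<lambda>v T. prod_list (map (x \<circ> fst) T) * fold U (map snd T) v z"
  have "p \<notin> set L" "distinct L"
    using Cons.prems by auto
  then have disj: "(#) p ` set (subseqs L) \<inter> set (subseqs L) = {}"
    using set_subseq by fastforce
  have "fold (\<lambda>(i, j). E j (x i)) (p # L) v z = (\<Sum>T\<in>set (subseqs L). ?f (E j (x i) v) T)"
    using Cons.IH[OF \<open>distinct L\<close>] by (simp add: p comp_def)
  also have "\<dots> = (\<Sum>T\<in>set (subseqs L). ?f v (p # T) + ?f v T)"
    by (simp add: E_def fold_U_lin p algebra_simps)
  also have "\<dots> = (\<Sum>T\<in>(#) p ` set (subseqs L). ?f v T) + (\<Sum>T\<in>set (subseqs L). ?f v T)"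
    by (simp add: sum.distrib sum.reindex)
  also have "\<dots> = (\<Sum>T\<in>set (subseqs (p # L)). ?f v T)"
    using disj by (simp add: sum.union_disjoint Let_def)
  finally show ?case .
qed simp

section \<open>Compatible sequences as subsequences of the factors\<close>

definition lex_less :: "nat \<times> nat \<Rightarrow> nat \<times> nat \<Rightarrow> bool" where
  "lex_less p q \<longleftrightarrow> fst p < fst q \<or> fst p = fst q \<and> snd q < snd p"

text \<open>The factors \<open>1 + x_i u_j\<close> of \<open>schub\<close> in order of application:
  i increases, and j decreases for fixed i.\<close>

definition pairs :: "nat \<Rightarrow> nat \<Rightarrow> (nat \<times> nat) list" where
  "pairs N k = concat (map (\<lambda>i. map (Pair i) (rev [i..<N])) [k..<N])"

lemma pairs_rec: "pairs N k = (if k < N then map (Pair k) (rev [k..<N]) @ pairs N (Suc k) else [])"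
  by (simp add: pairs_def upt_rec)

lemma set_pairs: "set (pairs N k) = {(i, j). k \<le> i \<and> i \<le> j \<and> j < N}"
  by (force simp: pairs_def)

lemma transp_lex_less: "transp lex_less"
  by (auto simp: lex_less_def transp_def)

lemma sorted_pairs: "sorted_wrt lex_less (pairs N k)"
proof (induction "N - k" arbitrary: k)
  case 0
  then show ?case by (simp add: pairs_rec)
next
  case (Suc m)
  have "sorted_wrt lex_less (map (Pair k) (rev [k..<N]))"
    by (simp add: sorted_wrt_map sorted_wrt_rev lex_less_def)
  moreover have "sorted_wrt lex_less (pairs N (Suc k))"
    using Suc by simp
  ultimately show ?case
    using Suc.hyps(2) unfolding pairs_rec[of N k] by (auto simp: sorted_wrt_append set_pairs lex_less_def)
qed

lemma distinct_pairs: "distinct (pairs N k)"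
proof -
  have "sorted_wrt lex_less L \<Longrightarrow> distinct L" for L
    by (induction L) (auto simp: lex_less_def)
  then show ?thesis
    using sorted_pairs by blast
qed

text \<open>For a list strictly sorted by a transitive irreflexive relation, choosing a subsequence
  is the same as listing a subset in order. This replaces subsequences by conditions on neighbouring
  entries.\<close>

lemma subseq_sorted_iff:
  assumes "sorted_wrt lex_less L"
  shows "subseq T L \<longleftrightarrow> sorted_wrt lex_less T \<and> set T \<subseteq> set L"
proof
  assume T: "subseq T L"
  have "subseq T L \<Longrightarrow> sorted_wrt lex_less L \<Longrightarrow> sorted_wrt lex_less T"
    by (induction rule: list_emb.induct) (use set_subseq in fastforce)+
  with T assms set_subseq show "sorted_wrt lex_less T \<and> set T \<subseteq> set L"
    by blast
next
  assume "sorted_wrt lex_less T \<and> set T \<subseteq> set L"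
  with assms show "subseq T L"
  proof (induction L arbitrary: T)
    case (Cons p L)
    show ?case
    proof (cases T)
      case T: (Cons t T')
      have irrefl: "\<not> lex_less q q" for q
        by (simp add: lex_less_def)
      show ?thesis
      proof (cases "t = p")
        case True
        then have "p \<notin> set T'"
          using Cons.prems irrefl[of p] by (auto simp: T)
        then have "subseq T' L"
          using Cons T by auto
        then show ?thesis
          by (simp add: T True)
      next
        case False
        then have "lex_less p t"
          using Cons.prems by (auto simp: T)
        then have "p \<notin> set T"
          using Cons.prems irrefl[of p] irrefl[of t] transpD[OF transp_lex_less, of t p t] by (auto simp: T)
        then have "subseq T L"
          using Cons by auto
        then show ?thesis
          by (rule list_emb_Cons)
      qed
    qed simp
  qed auto
qed

lemma schub_eq_fold: "schub N k x v = fold (\<lambda>(i, j). E j (x i)) (pairs N k) v"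
proof -
  have desc: "desc N i c = fold (\<lambda>(i, j). E j (x i)) (map (Pair i) (rev [i..<N]))" if "c = x i" for i c
    by (simp add: desc_def foldr_conv_fold fold_map comp_def that fun_eq_iff)
  have "fold (\<lambda>i. desc N i (x i)) js v =
      fold (\<lambda>(i, j). E j (x i)) (concat (map (\<lambda>i. map (Pair i) (rev [i..<N])) js)) v" for js
    by (induction js arbitrary: v) (simp_all add: desc[OF refl])
  then show ?thesis
    by (simp add: schub_def pairs_def)
qed

definition asc_pairs :: "nat \<Rightarrow> (nat \<Rightarrow> nat) \<Rightarrow> (nat \<Rightarrow> nat) \<Rightarrow> (nat \<times> nat) list set" where
  "asc_pairs N y z = {T \<in> set (subseqs (pairs N 1)).
     asc_path y (map snd T) \<and> foldl inv_act y (map snd T) = z}"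

lemma schub_eq_sum:
  assumes "invol y" "invol z"
  shows "schub N 1 x (delta y) z = (\<Sum>T\<in>asc_pairs N y z. prod_list (map (x \<circ> fst) T))"
proof -
  have "schub N 1 x (delta y) z = (\<Sum>T\<in>set (subseqs (pairs N 1)). prod_list (map (x \<circ> fst) T) *
      (if asc_path y (map snd T) \<and> foldl inv_act y (map snd T) = z then 1 else 0))"
    using assms by (simp only: schub_eq_fold fold_E_subseqs[OF distinct_pairs] fold_U_delta)
  also have "\<dots> = (\<Sum>T\<in>asc_pairs N y z. prod_list (map (x \<circ> fst) T))"
    unfolding asc_pairs_def by (intro sum.mono_neutral_cong_right) auto
  finally show ?thesis .
qed

lemma asc_path_distinct_adj:
  assumes "invol y" "asc_path y a"
  shows "distinct_adj a"
  using assms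
proof (induction a arbitrary: y)
  case (Cons i a)
  then have "distinct_adj a"
    using invol_inv_act by auto
  moreover have "hd a \<noteq> i" if "a \<noteq> []"
    using Cons.prems that inv_act_greater[OF Cons.prems(1), of i] by (cases a) auto
  ultimately show ?case
    by (cases a) auto
qed simp

text \<open>Sortedness of the pairs gives compatibility, i \<le> j gives the bound of I by a, and j
  < N is automatic because the letters lie below n.\<close>

lemma asc_pairs_iff:
  assumes y: "y \<in> involutions n" and z: "z \<in> involutions n" and "n \<le> N" and len: "length I = length a"
  shows "zip I a \<in> asc_pairs N y z \<longleftrightarrow>
    a \<in> inv_words_between y z \<and> I \<in> compatible_seqs a \<and> list_all2 (\<le>) I a"
proof -
  have snd: "map snd (zip I a) = a"
    using len by simp
  have 1: "zip I a \<in> asc_pairs N y z \<longleftrightarrow> sorted_wrt lex_less (zip I a) \<and>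
      set (zip I a) \<subseteq> {(i, j). 1 \<le> i \<and> i \<le> j \<and> j < N} \<and> asc_path y a \<and> foldl inv_act y a = z"
    by (simp only: asc_pairs_def mem_Collect_eq in_set_subseqs subseq_sorted_iff[OF sorted_pairs] set_pairs snd) blast
  have 2: "sorted_wrt lex_less (zip I a) \<longleftrightarrow>
      sorted I \<and> (\<forall>j. Suc j < length a \<longrightarrow> a ! j < a ! Suc j \<longrightarrow> I ! j < I ! Suc j)"
    if "distinct_adj a"
    unfolding sorted_wrt_iff_nth_Suc_transp[OF transp_lex_less] sorted_iff_nth_Suc
    using that unfolding distinct_adj_conv_nth by (fastforce simp: len lex_less_def)
  have 3: "set (zip I a) \<subseteq> {(i, j). 1 \<le> i \<and> i \<le> j \<and> j < N} \<longleftrightarrow>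
      0 \<notin> set I \<and> list_all2 (\<le>) I a \<and> 0 \<notin> set a" if a: "0 \<notin> set a \<Longrightarrow> set a \<subseteq> {1..<n}"
  proof -
    have "set (zip I a) \<subseteq> {(i, j). 1 \<le> i \<and> i \<le> j \<and> j < N} \<longleftrightarrow>
        (\<forall>t<length a. 1 \<le> I ! t \<and> I ! t \<le> a ! t \<and> a ! t < N)"
      using len by (auto simp: set_zip subset_iff)
    moreover have "0 \<notin> set I \<longleftrightarrow> (\<forall>t<length a. 1 \<le> I ! t)" "0 \<notin> set a \<longleftrightarrow> (\<forall>t<length a. 1 \<le> a ! t)"
      using len by (auto simp: in_set_conv_nth Suc_le_eq)
    moreover have "list_all2 (\<le>) I a \<longleftrightarrow> (\<forall>t<length a. I ! t \<le> a ! t)"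
      using len by (simp add: list_all2_conv_all_nth)
    moreover have "a ! t < N" if "0 \<notin> set a" "t < length a" for t
      using a[OF that(1)] nth_mem[OF that(2)] \<open>n \<le> N\<close> by (auto simp: subset_iff)
    ultimately show ?thesis
      by (meson order_trans)
  qed
  have 4: "set a \<subseteq> {1..<n}" if "0 \<notin> set a" "asc_path y a" "foldl inv_act y a = z"
    using asc_path_letters[OF invol_involutions[OF y] that(1,2)] that(3) z by simp
  have 5: "distinct_adj a" if "asc_path y a"
    using asc_path_distinct_adj[OF invol_involutions[OF y] that] .
  show ?thesis
    unfolding 1 inv_words_between_iff[OF y z] compatible_seqs_def mem_Collect_eq
    using 2 3 4 5 len by blast
qed

text \<open>\<open>dlen\<close> fixes the length of these words, and their letters are
  bounded.\<close>

lemma finite_inv_words_between: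
  assumes y: "y \<in> involutions n" and z: "z \<in> involutions n"
  shows "finite (inv_words_between y z)"
proof (rule finite_subset)
  show "inv_words_between y z \<subseteq> {b. set b \<subseteq> {1..<n} \<and> length b = (dlen z - dlen y) div 2}"
  proof
    fix b assume "b \<in> inv_words_between y z"
    then have b: "0 \<notin> set b" "asc_path y b" "foldl inv_act y b = z"
      by (auto simp: inv_words_between_iff[OF y z])
    then have "dlen z = dlen y + 2 * length b"
      using dlen_foldl(2)[OF invol_involutions[OF y], of b] by simp
    moreover have "set b \<subseteq> {1..<n}"
      using asc_path_letters[OF invol_involutions[OF y] b(1,2)] b(3) z by simp
    ultimately show "b \<in> {b. set b \<subseteq> {1..<n} \<and> length b = (dlen z - dlen y) div 2}"
      by simp
  qed
  show "finite {b. set b \<subseteq> {1..<n} \<and> length b = (dlen z - dlen y) div 2}"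
    by (rule finite_lists_length_eq) simp
qed

lemma finite_list_all2_le: "finite {I. list_all2 (\<le>) I (a :: nat list)}"
proof (rule finite_subset)
  show "{I. list_all2 (\<le>) I a} \<subseteq> {I. set I \<subseteq> {..Max (set a)} \<and> length I = length a}"
    by (fastforce simp: list_all2_conv_all_nth in_set_conv_nth intro: order_trans[OF _ Max_ge])
  show "finite {I. set I \<subseteq> {..Max (set a)} \<and> length I = length a}"
    by (rule finite_lists_length_eq) simp
qed

lemma inv_schubert_between_eq:
  assumes y: "y \<in> involutions n" and z: "z \<in> involutions n" and "n \<le> N"
  shows "inv_schubert_between y z = schub N 1 Var (delta y) z"
proof -
  let ?C = "\<lambda>a. {I \<in> compatible_seqs a. list_all2 (\<le>) I a}"
  have "finite (?C a)" for a
    using finite_list_all2_le by (rule finite_subset[rotated]) blast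
  then have "inv_schubert_between y z =
      (\<Sum>(a, I)\<in>(SIGMA a:inv_words_between y z. ?C a). prod_list (map Var I))"
    unfolding inv_schubert_between_def
    by (intro sum.Sigma finite_inv_words_between[OF y z] ballI)
  also have "\<dots> = (\<Sum>T\<in>asc_pairs N y z. prod_list (map (Var \<circ> fst) T))"
  proof (rule sum.reindex_bij_witness[of _ "\<lambda>T. (map snd T, map fst T)" "\<lambda>(a, I). zip I a"])
    fix aI assume "aI \<in> (SIGMA a:inv_words_between y z. ?C a)"
    then obtain a I where aI: "aI = (a, I)" "a \<in> inv_words_between y z" "I \<in> compatible_seqs a"
      "list_all2 (\<le>) I a"
      by auto
    then have len: "length I = length a"
      by (simp add: compatible_seqs_def)
    show "(\<lambda>T. (map snd T, map fst T)) ((\<lambda>(a, I). zip I a) aI) = aI"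
      using len by (simp add: aI(1))
    show "(\<lambda>(a, I). zip I a) aI \<in> asc_pairs N y z"
      using aI asc_pairs_iff[OF assms len] by simp
    show "prod_list (map (Var \<circ> fst) ((\<lambda>(a, I). zip I a) aI)) = (case aI of (a, I) \<Rightarrow> prod_list (map Var I))"
      using len by (simp add: aI(1) map_map[symmetric] del: map_map)
  next
    fix T assume "T \<in> asc_pairs N y z"
    then show "(map snd T, map fst T) \<in> (SIGMA a:inv_words_between y z. ?C a)"
      using asc_pairs_iff[OF assms, of "map fst T" "map snd T"] by (simp add: zip_map_fst_snd)
    show "(\<lambda>(a, I). zip I a) (map snd T, map fst T) = T"
      by (simp add: zip_map_fst_snd)
  qed
  also have "\<dots> = schub N 1 Var (delta y) z"
    by (rule schub_eq_sum[symmetric]) (use y z invol_involutions in auto)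
  finally show ?thesis .
qed

section \<open>Divided differences\<close>

lemma Var_neq: "i \<noteq> j \<Longrightarrow> Var i \<noteq> Var j"
  unfolding Var_def by (metis lookup_single_eq lookup_single_not_eq zero_neq_one)

lemma divdiff_eqI:
  assumes "g * (Var i - Var (Suc i)) = f - swap_vars i f"
  shows "divdiff i f = g"
  unfolding divdiff_def
proof (rule the_equality)
  show "g * (Var i - Var (i + 1)) = f - swap_vars i f"
    using assms by simp
  show "h = g" if "h * (Var i - Var (i + 1)) = f - swap_vars i f" for h
  proof -
    have "h * (Var i - Var (Suc i)) = g * (Var i - Var (Suc i))"
      using that assms by simp
    moreover have "Var i - Var (Suc i) \<noteq> 0"
      using Var_neq[of i "Suc i"] by simp
    ultimately show ?thesis
      unfolding mult_cancel_right by blast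
  qed
qed

lemma swap_vars_0 [simp]: "swap_vars i 0 = 0"
  by (rule poly_mapping_eqI) (simp add: lookup_swap_vars)

lemma swap_vars_add: "swap_vars i (f + g) = swap_vars i f + swap_vars i g"
  by (rule poly_mapping_eqI) (simp add: lookup_swap_vars lookup_add)

lemma swap_vars_sum: "swap_vars i (sum f S) = (\<Sum>s\<in>S. swap_vars i (f s))"
  by (induction S rule: infinite_finite_induct) (simp_all add: swap_vars_add)

lemma swap_vars_of_nat: "swap_vars i (of_nat m * f) = of_nat m * swap_vars i f"
  by (induction m) (simp_all add: swap_vars_add algebra_simps)

lemma swap_vars_single:
  "swap_vars i (Poly_Mapping.single m c) = Poly_Mapping.single (Poly_Mapping.map_key (simple_refl i) m) c"
  by (rule poly_mapping_eqI) (auto simp: lookup_swap_vars lookup_single when_def map_key_simple_refl_involutory)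

text \<open>Multiplicativity of \<open>swap_vars\<close> is established on monomials only, by
  carrying the exponent vector through the induction.\<close>

lemma swap_vars_prod_list: "swap_vars i (prod_list (map Var I)) = prod_list (map (Var \<circ> simple_refl i) I)"
proof -
  have "\<exists>m. prod_list (map Var I) = Poly_Mapping.single m 1 \<and>
      prod_list (map (Var \<circ> simple_refl i) I) = Poly_Mapping.single (Poly_Mapping.map_key (simple_refl i) m) 1"
  proof (induction I)
    case Nil
    then show ?case
      by (intro exI[of _ 0]) (simp add: map_key_zero[OF inj_simple_refl])
  next
    case (Cons j I)
    then obtain m where m: "prod_list (map Var I) = Poly_Mapping.single m 1"
      "prod_list (map (Var \<circ> simple_refl i) I) = Poly_Mapping.single (Poly_Mapping.map_key (simple_refl i) m) 1"
      by blast
    let ?m = "Poly_Mapping.single j 1 + m"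
    have "Var (simple_refl i j) = Poly_Mapping.single (Poly_Mapping.map_key (simple_refl i) (Poly_Mapping.single j 1)) 1"
      unfolding swap_vars_Var[symmetric] Var_def[of j] by (rule swap_vars_single)
    then have "prod_list (map (Var \<circ> simple_refl i) (j # I)) =
        Poly_Mapping.single (Poly_Mapping.map_key (simple_refl i) ?m) 1"
      unfolding map_key_plus[OF inj_simple_refl] by (simp only: list.map prod_list.Cons m comp_apply mult_single mult_1)
    moreover have "prod_list (map Var (j # I)) = Poly_Mapping.single ?m 1"
      by (simp only: list.map prod_list.Cons m Var_def mult_single mult_1)
    ultimately show ?case
      by blast
  qed
  then obtain m where "prod_list (map Var I) = Poly_Mapping.single m 1"
      "prod_list (map (Var \<circ> simple_refl i) I) = Poly_Mapping.single (Poly_Mapping.map_key (simple_refl i) m) 1"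
    by blast
  then show ?thesis
    by (simp only: swap_vars_single)
qed

lemma swap_vars_schub:
  assumes "invol y" "invol z"
  shows "swap_vars i (schub N 1 Var (delta y) z) = schub N 1 (Var \<circ> simple_refl i) (delta y) z"
proof -
  have "swap_vars i (prod_list (map (Var \<circ> fst) T)) = prod_list (map (Var \<circ> simple_refl i \<circ> fst) T)"
    for T :: "(nat \<times> nat) list"
    using swap_vars_prod_list[of i "map fst T"] by (simp only: map_map)
  then show ?thesis
    by (simp only: schub_eq_sum[OF assms] swap_vars_sum)
qed

text \<open>\<open>schub_diff\<close> at z, where \<open>U i\<close> reads the coefficient at
  \<open>inv_act z i\<close>. The factor \<open>of_nat m\<close> will carry a power of 2.\<close>

lemma divdiff_inv_schubert_between:
  assumes y: "y \<in> involutions n" and z: "z \<in> involutions n" and d: "z (Suc i) < z i"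
  shows "divdiff i (of_nat m * inv_schubert_between y z) = of_nat m * inv_schubert_between y (inv_act z i)"
proof (rule divdiff_eqI)
  have i: "0 < i" "i < n"
    using z d descent_less descent_pos by blast+
  have invol: "invol y" "invol z"
    using y z invol_involutions by blast+
  \<comment> \<open>N = n+1 rather than n, so that \<open>schub_diff\<close> also covers i =
    n-1.\<close>
  have schub: "inv_schubert_between y w = schub (Suc n) 1 Var (delta y) w" if "w \<in> involutions n" for w
    using inv_schubert_between_eq[OF y that] by simp
  have "Var \<circ> simple_refl i = Var(i := Var (Suc i), Suc i := Var i)"
    by (auto simp: fun_eq_iff simple_refl_apply)
  then have "schub (Suc n) 1 Var (delta y) z - schub (Suc n) 1 (Var \<circ> simple_refl i) (delta y) z =
      (Var i - Var (Suc i)) * U i (schub (Suc n) 1 Var (delta y)) z"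
    using i by (intro schub_diff) auto
  then have "inv_schubert_between y z - swap_vars i (inv_schubert_between y z) =
      (Var i - Var (Suc i)) * inv_schubert_between y (inv_act z i)"
    using d invol by (simp add: schub z inv_act_in_involutions i swap_vars_schub U_apply del: One_nat_def)
  then show "of_nat m * inv_schubert_between y (inv_act z i) * (Var i - Var (Suc i)) =
      of_nat m * inv_schubert_between y z - swap_vars i (of_nat m * inv_schubert_between y z)"
    by (simp add: swap_vars_of_nat right_diff_distrib[symmetric] mult_ac)
qed

text \<open>\<open>divdiff_word\<close> applies the last letter first, so it walks the ascending
  path backwards from z to w.\<close>

lemma divdiff_word_inv_schubert_between:
  assumes "y \<in> involutions n" "w \<in> involutions n" "z \<in> involutions n" "b \<in> inv_words_between w z"
  shows "divdiff_word b (of_nat m * inv_schubert_between y z) = of_nat m * inv_schubert_between y w"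
proof -
  have "divdiff_word b (of_nat m * inv_schubert_between y z) = of_nat m * inv_schubert_between y w"
    if "w \<in> involutions n" "asc_path w b" "set b \<subseteq> {1..<n}" "foldl inv_act w b = z" for w
    using that
  proof (induction b arbitrary: w)
    case (Cons i b)
    have w: "invol w" "inv_act w i \<in> involutions n"
      using Cons.prems inv_act_in_involutions[of w n i] invol_involutions by auto
    have "divdiff_word b (of_nat m * inv_schubert_between y z) = of_nat m * inv_schubert_between y (inv_act w i)"
      using Cons w by simp
    then show ?case
      using divdiff_inv_schubert_between[OF assms(1) w(2), of i m] Cons.prems w
      by (simp add: divdiff_word_def inv_act_greater inv_act_inv_act)
  qed (simp add: divdiff_word_def)
  note path = this
  have b: "0 \<notin> set b" "asc_path w b" "foldl inv_act w b = z"
    using assms(4) by (auto simp: inv_words_between_iff[OF assms(2,3)])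
  then have "set b \<subseteq> {1..<n}"
    using asc_path_letters[OF invol_involutions[OF assms(2)] b(1,2)] assms(3) by simp
  then show ?thesis
    using path[OF assms(2)] b by simp
qed

section \<open>The longest element\<close>

lemma flip_id_1: "flip id N 1 = longest_perm N"
  by (auto simp: flip_def longest_perm_def fun_eq_iff)

lemma inv_act_id: "inv_act id i = simple_refl i"
  by (simp add: inv_act_def)

text \<open>Both orders lead to the transposition of i and i+2.\<close>

lemma delta_id_commuting: "U (Suc i) (U i (delta id)) = U i (U (Suc i) (delta id))"
proof -
  have invol: "invol (simple_refl j)" for j
    using invol_inv_act[OF invol_id, of j] by (simp add: inv_act_id)
  have "inv_act (simple_refl i) (Suc i) = inv_act (simple_refl (Suc i)) i"
    by (rule ext) (auto simp: inv_act_apply[OF invol] simple_refl_apply)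
  then show ?thesis
    by (simp add: U_delta inv_act_id invol)
qed

text \<open>After t rounds k has moved by 2t but the variables only by t. Each round contributes
  \<open>x_{t+1}\<close> and one factor 2, which together make the diagonal term
  \<open>x_{t+1} + x_{t+1}\<close>; the power of 2 counts the remaining rounds.\<close>

lemma schub_longest_peeled:
  "2 ^ ((N - 2 * t) div 2) * schub N (2 * t + 1) (\<lambda>j. Var (j - t)) (delta id) (flip id N (2 * t + 1)) =
    (\<Prod>i = t + 1..N. \<Prod>j = i..N - i. Var i + Var j)"
proof (induction "N - t" arbitrary: t rule: less_induct)
  case less
  show ?case
  proof (cases "2 * t + 1 < N")
    case False
    then have "flip id N (2 * t + 1) = id"
      by (auto simp: flip_def fun_eq_iff)
    moreover have "(\<Prod>i = t + 1..N. \<Prod>j = i..N - i. Var i + Var j) = 1"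
      using False by (intro prod.neutral) auto
    ultimately show ?thesis
      using False by (simp add: schub_rec delta_def)
  next
    case True
    let ?k = "2 * t + 1"
    let ?s = "schub N (2 * Suc t + 1) (\<lambda>j. Var (j - Suc t)) (delta id) (flip id N (2 * Suc t + 1))"
    have "schub N ?k (\<lambda>j. Var (j - t)) (delta id) (flip id N ?k) = (if id ?k = ?k then Var (?k - t) else 1) *
        (\<Prod>j = Suc ?k..<N. Var (?k - t) + Var (j - t)) *
        schub N (Suc (Suc ?k)) (\<lambda>j. Var (j - 1 - t)) (delta id) (flip id N (Suc (Suc ?k)))"
      using True by (intro schub_top_peel[where x = "\<lambda>j. Var (j - t)"] desc_eq_asc_if_commuting delta_id_commuting) auto
    also have "(\<Prod>j = Suc ?k..<N. Var (?k - t) + Var (j - t)) = (\<Prod>j = Suc (t + 1)..N - (t + 1). Var (t + 1) + Var j)"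
      using True by (intro prod.reindex_bij_witness[of _ "\<lambda>j. j + t" "\<lambda>j. j - t"]) auto
    finally have peel: "schub N ?k (\<lambda>j. Var (j - t)) (delta id) (flip id N ?k) =
        Var (t + 1) * (\<Prod>j = Suc (t + 1)..N - (t + 1). Var (t + 1) + Var j) * ?s"
      by (simp add: numeral_2_eq_2 id_def)
    have two: "2 * Var (t + 1) * (\<Prod>j = Suc (t + 1)..N - (t + 1). Var (t + 1) + Var j) =
        (\<Prod>j = t + 1..N - (t + 1). Var (t + 1) + Var j)"
    proof -
      have "(\<Prod>j = t + 1..N - (t + 1). Var (t + 1) + Var j) =
          (Var (t + 1) + Var (t + 1)) * (\<Prod>j = Suc (t + 1)..N - (t + 1). Var (t + 1) + Var j)"
        using True by (intro prod.atLeast_Suc_atMost) simp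
      then show ?thesis
        by (simp only: mult_2)
    qed
    have "(N - 2 * t) div 2 = Suc ((N - 2 * Suc t) div 2)"
      using True by simp
    then have "2 ^ ((N - 2 * t) div 2) * schub N ?k (\<lambda>j. Var (j - t)) (delta id) (flip id N ?k) =
        (2 * Var (t + 1) * (\<Prod>j = Suc (t + 1)..N - (t + 1). Var (t + 1) + Var j)) * (2 ^ ((N - 2 * Suc t) div 2) * ?s)"
      unfolding peel by (simp only: power_Suc mult_ac)
    also have "2 ^ ((N - 2 * Suc t) div 2) * ?s = (\<Prod>i = Suc t + 1..N. \<Prod>j = i..N - i. Var i + Var j)"
      using True by (intro less.hyps) auto
    also have "2 * Var (t + 1) * (\<Prod>j = Suc (t + 1)..N - (t + 1). Var (t + 1) + Var j) *
        (\<Prod>i = Suc t + 1..N. \<Prod>j = i..N - i. Var i + Var j) =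
        (\<Prod>i = t + 1..N. \<Prod>j = i..N - i. Var i + Var j)"
      unfolding two add_Suc using True by (intro prod.atLeast_Suc_atMost[symmetric]) simp
    finally show ?thesis .
  qed
qed

lemma inv_schubert_longest:
  "2 ^ (n div 2) * inv_schubert (longest_perm n) = upsilon_O_longest n"
proof -
  have "inv_schubert (longest_perm n) = schub n 1 Var (delta id) (flip id n 1)"
    unfolding inv_schubert_def flip_id_1
    by (rule inv_schubert_between_eq[OF id_in_involutions longest_perm_in_involutions order_refl])
  then show ?thesis
    using schub_longest_peeled[of n 0] by (simp add: upsilon_O_longest_def)
qed

section \<open>The fixed-point-free starting point\<close>

lemma fpf_base_odd: "odd i \<Longrightarrow> i < 2 * n \<Longrightarrow> fpf_base n i = Suc i \<and> fpf_base n (Suc i) = i"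
  by (auto simp: fpf_base_def elim!: oddE)

lemma fpf_base_parity:
  assumes "odd m" "i \<noteq> m" "i \<noteq> Suc m" "Suc m \<le> 2 * n"
  shows "fpf_base n i \<noteq> m \<and> fpf_base n i \<noteq> Suc m"
  using fpf_base_odd[OF assms(1), of n] assms
    invol_apply[OF invol_involutions[OF fpf_base_in_involutions[of n]], of i]
  by (metis Suc_le_lessD)

lemma delta_fpf_base_odd:
  assumes "odd i" "i < 2 * n"
  shows "U i (delta (fpf_base n)) = (\<lambda>_. 0)"
  using fpf_base_odd[OF assms] by (simp add: U_delta invol_involutions[OF fpf_base_in_involutions])

text \<open>With i = m+1, the pairs (m, m+1), (m+2, m+3) become (m, m+2), (m+1, m+3) under u_i; then
  u_m and u_{m+2} both give (m, m+3), (m+1, m+2).\<close>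

lemma delta_fpf_base_even:
  assumes "even i" "0 < i" "i < 2 * n"
  shows "U (i - 1) (U i (delta (fpf_base n))) = U (Suc i) (U i (delta (fpf_base n)))"
proof -
  obtain m where m: "i = Suc m" "odd m"
    using assms by (cases i) auto
  have bound: "Suc (Suc (Suc m)) \<le> 2 * n"
  proof -
    obtain b where "m = 2 * b + 1"
      using m(2) by (elim oddE)
    then show ?thesis
      using assms(3) m(1) by presburger
  qed
  let ?v = "fpf_base n"
  let ?w = "inv_act ?v (Suc m)"
  have invol: "invol ?v" "invol ?w"
    using invol_involutions[OF fpf_base_in_involutions] invol_inv_act by blast+
  have v: "?v m = Suc m" "?v (Suc m) = m" "?v (Suc (Suc m)) = Suc (Suc (Suc m))"
    "?v (Suc (Suc (Suc m))) = Suc (Suc m)"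
    using fpf_base_odd[of m n] fpf_base_odd[of "Suc (Suc m)" n] m bound by auto
  have other: "?v x \<noteq> m \<and> ?v x \<noteq> Suc m \<and> ?v x \<noteq> Suc (Suc m) \<and> ?v x \<noteq> Suc (Suc (Suc m))"
    if "x \<noteq> m" "x \<noteq> Suc m" "x \<noteq> Suc (Suc m)" "x \<noteq> Suc (Suc (Suc m))" for x
    using fpf_base_parity[of m x n] fpf_base_parity[of "Suc (Suc m)" x n] m bound that by auto
  have w: "?w x = (if x = m then Suc (Suc m) else if x = Suc m then Suc (Suc (Suc m))
      else if x = Suc (Suc m) then m else if x = Suc (Suc (Suc m)) then Suc m else ?v x)" for x
    using v other[of x] by (auto simp: inv_act_apply[OF invol(1)] simple_refl_apply)
  have "inv_act ?w m x = inv_act ?w (Suc (Suc m)) x" for x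
    using other[of x] by (simp add: inv_act_apply[OF invol(2)] w simple_refl_apply)
  then have "inv_act ?w m = inv_act ?w (Suc (Suc m))"
    by blast
  then show ?thesis
    by (simp add: m U_delta invol v w)
qed

text \<open>As for the identity, except that k is already paired with k+1. No factor
  \<open>x_{t+1}\<close> arises, hence neither diagonal terms nor powers of 2.\<close>

lemma schub_fpf_longest_peeled:
  assumes "t \<le> n"
  shows "schub (2 * n) (2 * t + 1) (\<lambda>j. Var (j - t)) (delta (fpf_base n)) (flip (fpf_base n) (2 * n) (2 * t + 1)) =
    (\<Prod>i = t + 1..2 * n. \<Prod>j = i + 1..2 * n - i. Var i + Var j)"
  using assms
proof (induction "n - t" arbitrary: t)
  case 0
  then have "t = n" by simp
  moreover have "flip (fpf_base n) (2 * n) (2 * n + 1) = fpf_base n"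
    by (auto simp: flip_def fun_eq_iff)
  moreover have "(\<Prod>i = n + 1..2 * n. \<Prod>j = i + 1..2 * n - i. Var i + Var j) = 1"
    by (intro prod.neutral) auto
  ultimately show ?case
    by (simp add: schub_rec delta_def)
next
  case (Suc m)
  let ?v = "fpf_base n" and ?k = "2 * t + 1" and ?N = "2 * n"
  let ?s = "schub ?N (2 * Suc t + 1) (\<lambda>j. Var (j - Suc t)) (delta ?v) (flip ?v ?N (2 * Suc t + 1))"
  have t: "t < n" using Suc by simp
  have vk: "?v ?k = Suc ?k" "?v (Suc ?k) = ?k"
    using fpf_base_odd[of ?k n] t by auto
  have less: "?v i < ?k" if "i < ?k" for i
    using that t by (auto simp: fpf_base_def elim!: oddE)
  have "schub ?N ?k (\<lambda>j. Var (j - t)) (delta ?v) (flip ?v ?N ?k) = (if ?v ?k = ?k then Var (?k - t) else 1) *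
      (\<Prod>j = Suc ?k..<?N. Var (?k - t) + Var (j - t)) *
      schub ?N (Suc (Suc ?k)) (\<lambda>j. Var (j - 1 - t)) (delta ?v) (flip ?v ?N (Suc (Suc ?k)))"
  proof (rule schub_top_peel[where x = "\<lambda>j. Var (j - t)"])
    show "invol ?v"
      by (rule invol_involutions[OF fpf_base_in_involutions])
    show "?v i = i" if "?N < i" for i
      using that by (simp add: fpf_base_def)
    show "desc ?N ?k (Var (?k - t)) (delta ?v) = asc ?N ?k (\<lambda>_. Var (?k - t)) (delta ?v)"
      by (rule desc_eq_asc_if_fpf) (simp_all add: delta_fpf_base_odd delta_fpf_base_even del: One_nat_def)
  qed (use t vk less in auto)
  also have "(\<Prod>j = Suc ?k..<?N. Var (?k - t) + Var (j - t)) = (\<Prod>j = t + 1 + 1..?N - (t + 1). Var (t + 1) + Var j)"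
    using t by (intro prod.reindex_bij_witness[of _ "\<lambda>j. j + t" "\<lambda>j. j - t"]) auto
  finally have peel: "schub ?N ?k (\<lambda>j. Var (j - t)) (delta ?v) (flip ?v ?N ?k) =
      (\<Prod>j = t + 1 + 1..?N - (t + 1). Var (t + 1) + Var j) * ?s"
    using vk by (simp add: numeral_2_eq_2)
  also have "?s = (\<Prod>i = Suc t + 1..?N. \<Prod>j = i + 1..?N - i. Var i + Var j)"
    using Suc t by (intro Suc.hyps) auto
  also have "(\<Prod>j = t + 1 + 1..?N - (t + 1). Var (t + 1) + Var j) * \<dots> =
      (\<Prod>i = t + 1..?N. \<Prod>j = i + 1..?N - i. Var i + Var j)"
    unfolding add_Suc using t by (intro prod.atLeast_Suc_atMost[symmetric]) simp
  finally show ?case .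
qed

lemma fpf_inv_schubert_longest: "fpf_inv_schubert n (longest_perm (2 * n)) = upsilon_Sp_longest n"
proof -
  have "flip (fpf_base n) (2 * n) 1 = longest_perm (2 * n)"
    by (auto simp: flip_def longest_perm_def fpf_base_def fun_eq_iff)
  then have "fpf_inv_schubert n (longest_perm (2 * n)) =
      schub (2 * n) 1 Var (delta (fpf_base n)) (flip (fpf_base n) (2 * n) 1)"
    unfolding fpf_inv_schubert_def
    by (metis inv_schubert_between_eq fpf_base_in_involutions longest_perm_in_involutions order_refl)
  then show ?thesis
    using schub_fpf_longest_peeled[of 0 n] by (simp add: upsilon_Sp_longest_def)
qed

lemma num_two_cycles_longest_perm: "num_two_cycles (longest_perm n) = n div 2"
proof -
  have "{(i, j). i < j \<and> longest_perm n i = j \<and> longest_perm n j = i} = (\<lambda>i. (i, n + 1 - i)) ` {1..n div 2}"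
    by (auto simp: longest_perm_def image_iff split: if_splits)
  moreover have "inj_on (\<lambda>i. (i, n + 1 - i)) S" for S
    by (auto simp: inj_on_def)
  ultimately show ?thesis
    by (simp add: num_two_cycles_def card_image)
qed

lemma Const_mult: "Const c * Const d = Const (c * d)"
  by (simp add: Const_def mult_single)

lemma Const_of_nat: "Const (of_nat m) = of_nat m"
  by (simp add: Const_def)

lemma inv_words_between_longest_nonempty:
  "y \<in> involutions n \<Longrightarrow> inv_words_between y (longest_perm n) \<noteq> {}"
  using exists_word_to_longest inv_words_between_iff[OF _ longest_perm_in_involutions] by blast

theorem theorem1p2:
  fixes n :: nat and y z :: "nat \<Rightarrow> nat"
  assumes "n > 0"
    and "y \<in> involutions n"
    and "z \<in> fpf_involutions (2 * n)"
  shows "2 ^ num_two_cycles y * inv_schubert y = upsilon_O n y \<and>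
         fpf_inv_schubert n z = upsilon_Sp n z"
proof
  let ?w = "longest_perm n"
  let ?c = "(2::rat) powi (int (num_two_cycles y) - int (num_two_cycles ?w))"
  have "Const ?c * divdiff_word a (upsilon_O_longest n) = 2 ^ num_two_cycles y * inv_schubert y"
    if "a \<in> inv_words_between y ?w" for a
  proof -
    have "upsilon_O_longest n = of_nat (2 ^ num_two_cycles ?w) * inv_schubert_between id ?w"
      using inv_schubert_longest[of n] by (simp add: num_two_cycles_longest_perm inv_schubert_def)
    then have "divdiff_word a (upsilon_O_longest n) = of_nat (2 ^ num_two_cycles ?w) * inv_schubert y"
      using divdiff_word_inv_schubert_between[OF id_in_involutions assms(2) longest_perm_in_involutions that]
      by (simp only: inv_schubert_def)
    \<comment> \<open>The power of 2 lost in passing from \<open>inv_schubert\<close> to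
      \<open>upsilon_O_longest\<close> cancels the negative part of the exponent.\<close>
    moreover have "Const ?c * of_nat (2 ^ num_two_cycles ?w) = 2 ^ num_two_cycles y"
    proof -
      have "?c * of_nat (2 ^ num_two_cycles ?w) = of_nat (2 ^ num_two_cycles y)"
        by (simp add: power_int_diff)
      then have "Const ?c * Const (of_nat (2 ^ num_two_cycles ?w)) = Const (of_nat (2 ^ num_two_cycles y))"
        by (simp only: Const_mult)
      then show ?thesis
        by (simp only: Const_of_nat) simp
    qed
    ultimately show ?thesis
      by (simp only: mult.assoc[symmetric])
  qed
  \<comment> \<open>All words give the same polynomial and at least one word exists, so the definite
    description is met.\<close>
  then show "2 ^ num_two_cycles y * inv_schubert y = upsilon_O n y"
    unfolding upsilon_O_def using inv_words_between_longest_nonempty[OF assms(2)]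
    by (intro the_equality[symmetric]) auto
next
  have z: "z \<in> involutions (2 * n)"
    using assms(3) by (simp add: fpf_involutions_def)
  have "divdiff_word a (upsilon_Sp_longest n) = fpf_inv_schubert n z"
    if "a \<in> inv_words_between z (longest_perm (2 * n))" for a
    \<comment> \<open>The multiplier is 1, as no power of 2 occurs in the symplectic case.\<close>
    using divdiff_word_inv_schubert_between[OF fpf_base_in_involutions z longest_perm_in_involutions that, of 1]
    by (simp add: fpf_inv_schubert_longest[symmetric] fpf_inv_schubert_def)
  then show "fpf_inv_schubert n z = upsilon_Sp n z"
    unfolding upsilon_Sp_def using inv_words_between_longest_nonempty[OF z]
    by (intro the_equality[symmetric]) auto
qed

end
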